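(* For any $(A,B,C,D)\in\mathbf{C}^4$, the morphism $$\Gamma_2^*\to \mathrm{Aut}[S_{(A,B,C,D)}],\qquad M\mapsto f_M,$$ is injective and the index of its image in $\mathrm{Aut}[S_{(A,B,C,D)}]$ is at most $24$. For a generic choice of the parameters $(A,B,C,D)$, this morphism is an isomorphism.
   Context: For $(A,B,C,D)\in\mathbf{C}^4$, $S_{(A,B,C,D)}\subset\mathbf{C}^3$ is the affine cubic surface $x^2+y^2+z^2+xyz=Ax+By+Cz+D$, and $\mathrm{Aut}[S_{(A,B,C,D)}]$ is the group of polynomial automorphisms of this affine surface. $\Gamma_2^*=\{M\in \mathrm{PGL}(2,\mathbf{Z}) : M\equiv \mathrm{Id} \bmod 2\}$; it is the free product of the three groups of order two generated by $s_x=\begin{pmatrix}-1&2\\0&1\end{pmatrix}$, $s_y=\begin{pmatrix}1&0\\2&-1\end{pmatrix}$, $s_z=\begin{pmatrix}1&0\\0&-1\end{pmatrix}$. It acts on $S_{(A,B,C,D)}$ through the group morphism $M\mapsto f_M$ that sends $s_x,s_y,s_z$ respectively to $(x,y,z)\mapsto(A-x-yz,y,z)$, $(x,y,z)\mapsto(x,B-y-xz,z)$, $(x,y,z)\mapsto(x,y,C-z-xy)$. "Generic" means outside a proper Zariski closed subset of the parameter space $\mathbf{C}^4$. *)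

theory Defs
  imports "HOL-Analysis.Analysis" "HOL-Algebra.Coset" "HOL-Algebra.Bij" "HOL-Number_Theory.Cong"
begin

section \<open>Polynomial maps and Zariski closed sets\<close>

text \<open>The complex counterpart of \<^const>\<open>real_polynomial_function\<close>.\<close>

inductive complex_polynomial_function :: "(complex ^ 'n \<Rightarrow> complex) \<Rightarrow> bool" where
  coord: "complex_polynomial_function (\<lambda>v. v $ i)"
| const: "complex_polynomial_function (\<lambda>v. c)"
| add: "\<lbrakk>complex_polynomial_function f; complex_polynomial_function g\<rbrakk>
    \<Longrightarrow> complex_polynomial_function (\<lambda>v. f v + g v)"
| mult: "\<lbrakk>complex_polynomial_function f; complex_polynomial_function g\<rbrakk>
    \<Longrightarrow> complex_polynomial_function (\<lambda>v. f v * g v)"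

definition complex_polynomial_map :: "(complex ^ 'n \<Rightarrow> complex ^ 'm) \<Rightarrow> bool" where
  "complex_polynomial_map F \<longleftrightarrow> (\<forall>i. complex_polynomial_function (\<lambda>v. F v $ i))"

definition zariski_closed :: "(complex ^ 'n) set \<Rightarrow> bool" where
  "zariski_closed Z \<longleftrightarrow>
    (\<exists>P. (\<forall>f\<in>P. complex_polynomial_function f) \<and> Z = {v. \<forall>f\<in>P. f v = 0})"


section \<open>The cubic surface and its polynomial automorphisms\<close>

definition cubic_surface :: "complex \<Rightarrow> complex \<Rightarrow> complex \<Rightarrow> complex \<Rightarrow> (complex ^ 3) set" where
  "cubic_surface A B C D =
    {v. (v $ 1)\<^sup>2 + (v $ 2)\<^sup>2 + (v $ 3)\<^sup>2 + v $ 1 * v $ 2 * v $ 3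
        = A * v $ 1 + B * v $ 2 + C * v $ 3 + D}"

definition regular_self_map :: "(complex ^ 'n) set \<Rightarrow> (complex ^ 'n \<Rightarrow> complex ^ 'n) \<Rightarrow> bool" where
  "regular_self_map S f \<longleftrightarrow>
    f ` S \<subseteq> S \<and> (\<exists>F. complex_polynomial_map F \<and> (\<forall>v\<in>S. f v = F v))"

text \<open>
  The group law is that of \<^const>\<open>BijGroup\<close>: composition, with automorphisms represented by
  functions that are \<^const>\<open>undefined\<close> outside \<open>S\<close>. The cubic equation is irreducible for all
  parameters, so automorphisms of the affine variety are determined by the underlying maps of
  complex points.
\<close>

definition poly_Aut :: "(complex ^ 'n) set \<Rightarrow> (complex ^ 'n \<Rightarrow> complex ^ 'n) monoid" where
  "poly_Aut S = (BijGroup S)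
    \<lparr>carrier := {f \<in> Bij S. regular_self_map S f \<and> regular_self_map S (inv_into S f)}\<rparr>"


section \<open>The group \<open>\<Gamma>\<^sub>2\<^sup>*\<close>\<close>

definition GL2Z :: "(int ^ 2 ^ 2) monoid" where
  "GL2Z = units_of \<lparr>carrier = UNIV, mult = (**), one = mat 1\<rparr>"

definition pm_one :: "(int ^ 2 ^ 2) set" where
  "pm_one = {mat 1, - mat 1}"

definition PGL2Z :: "(int ^ 2 ^ 2) set monoid" where
  "PGL2Z = GL2Z Mod pm_one"

definition proj_class :: "int ^ 2 ^ 2 \<Rightarrow> (int ^ 2 ^ 2) set" where
  "proj_class M = pm_one #>\<^bsub>GL2Z\<^esub> M"

text \<open>The congruence does not depend on the representative, because \<open>1\<close> and \<open>-1\<close> agree modulo \<open>2\<close>.\<close>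

definition Gamma2 :: "(int ^ 2 ^ 2) set monoid" where
  "Gamma2 = PGL2Z
    \<lparr>carrier := {X \<in> carrier PGL2Z. \<exists>M\<in>X. \<forall>i j. [M $ i $ j = mat 1 $ i $ j] (mod 2)}\<rparr>"

definition gen_x :: "(int ^ 2 ^ 2) set" where
  "gen_x = proj_class (vector [vector [-1, 2], vector [0, 1]])"

definition gen_y :: "(int ^ 2 ^ 2) set" where
  "gen_y = proj_class (vector [vector [1, 0], vector [2, -1]])"

definition gen_z :: "(int ^ 2 ^ 2) set" where
  "gen_z = proj_class (vector [vector [1, 0], vector [0, -1]])"


section \<open>The action of \<open>\<Gamma>\<^sub>2\<^sup>*\<close> on the surface\<close>

definition inv_x :: "complex \<Rightarrow> complex ^ 3 \<Rightarrow> complex ^ 3" where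
  "inv_x A v = vector [A - v $ 1 - v $ 2 * v $ 3, v $ 2, v $ 3]"

definition inv_y :: "complex \<Rightarrow> complex ^ 3 \<Rightarrow> complex ^ 3" where
  "inv_y B v = vector [v $ 1, B - v $ 2 - v $ 1 * v $ 3, v $ 3]"

definition inv_z :: "complex \<Rightarrow> complex ^ 3 \<Rightarrow> complex ^ 3" where
  "inv_z C v = vector [v $ 1, v $ 2, C - v $ 3 - v $ 1 * v $ 2]"

definition is_surface_action ::
  "complex \<Rightarrow> complex \<Rightarrow> complex \<Rightarrow> complex \<Rightarrow>
    ((int ^ 2 ^ 2) set \<Rightarrow> complex ^ 3 \<Rightarrow> complex ^ 3) \<Rightarrow> bool" where
  "is_surface_action A B C D \<phi> \<longleftrightarrow>
    \<phi> \<in> hom Gamma2 (poly_Aut (cubic_surface A B C D)) \<and>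
    \<phi> \<in> extensional (carrier Gamma2) \<and>
    \<phi> gen_x = restrict (inv_x A) (cubic_surface A B C D) \<and>
    \<phi> gen_y = restrict (inv_y B) (cubic_surface A B C D) \<and>
    \<phi> gen_z = restrict (inv_z C) (cubic_surface A B C D)"

text \<open>
  Exactly one such morphism exists, because \<^const>\<open>Gamma2\<close> is the free product of its
  subgroups of order two generated by \<^const>\<open>gen_x\<close>, \<^const>\<open>gen_y\<close> and \<^const>\<open>gen_z\<close>.
\<close>

definition surface_action ::
  "complex \<Rightarrow> complex \<Rightarrow> complex \<Rightarrow> complex \<Rightarrow>
    (int ^ 2 ^ 2) set \<Rightarrow> complex ^ 3 \<Rightarrow> complex ^ 3" where
  "surface_action A B C D = (THE \<phi>. is_surface_action A B C D \<phi>)"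

end

theory Submission
  imports Defs "HOL-Computational_Algebra.Polynomial"
begin

text \<open>
  The three involutions \<open>s\<^sub>x, s\<^sub>y, s\<^sub>z\<close> are treated as letters, and both the matrices and the
  maps of the surface as images of words. \<^emph>\<open>Freeness.\<close> A nonempty reduced word moves some point on
  either side, by ping-pong. For an integer vector \<open>(u, v)\<close> compare \<open>\<bar>u\<bar>, \<bar>v\<bar>, \<bar>u - v\<bar>\<close>; for a point
  of the surface with large coordinates compare \<open>\<bar>x\<bar>, \<bar>y\<bar>, \<bar>z\<bar>\<close>. If the strict maximum is in one
  position, each of the other two letters moves it to its own position and increases it. Hence two words
  have the same matrix class iff they act in the same way on the surface, whatever the parameters are
  (\<open>word_class_eq_imp_act\<close>, \<open>word_act_eq_imp_word_class\<close>). Since the letters generate \<open>\<Gamma>\<^sub>2\<^sup>*\<close>, by the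
  Euclidean algorithm, this gives existence, uniqueness and injectivity of the action.

  \<^emph>\<open>Automorphisms.\<close> The core is \<open>isomorphism_reducible\<close>: a polynomial isomorphism between two surfaces
  of the family, composed with a suitable word, is a permutation of the coordinates with signs of
  product 1. Over \<open>\<complex>[z]\<close> the coordinate ring \<open>R\<close> is generated by \<open>x\<close> and \<open>y\<close>, subject to
  \<open>x\<^sup>2 + z x y + y\<^sup>2 + \<dots> = 0\<close>. Because \<open>z\<^sup>2 - 4\<close> is not a square, the leading quadratic form is
  anisotropic over \<open>\<complex>(z)\<close>, so the degree \<open>\<delta>\<close> in \<open>(x, y)\<close> is additive on nonzero products, and \<open>\<delta>(f) = 0\<close>
  iff \<open>f\<close> lies in \<open>\<complex>[z]\<close>. Let \<open>(P, Q, T)\<close> be the components of an isomorphism.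
  They satisfy the equation of the target surface, and as long as \<open>\<delta>(P), \<delta>(Q), \<delta>(T)\<close> are all
  positive an involution lowers the largest of them, as in Markov's descent (\<open>markov_vieta_degree\<close>).
  In the end one component, say \<open>T\<close>, lies in \<open>\<complex>[z]\<close>. Applying the same reasoning to the inverse shows
  that \<open>T\<close> is affine in \<open>z\<close> and that \<open>\<delta>(P) = \<delta>(Q) = 1\<close>, so that \<open>P = a\<^sub>1 + b\<^sub>1 x + c\<^sub>1 y\<close> and
  \<open>Q = a\<^sub>2 + b\<^sub>2 x + c\<^sub>2 y\<close> with coefficients in \<open>\<complex>[z]\<close> and constant determinant. Comparing discriminants
  gives \<open>T = \<plusminus>z\<close>, and a Pell-type equation \<open>b\<^sub>1\<^sup>2 + b\<^sub>2\<^sup>2 + T b\<^sub>1 b\<^sub>2 = l\<close> remains; the two involutions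
  that fix \<open>T\<close> lower \<open>deg b\<^sub>1 + deg b\<^sub>2\<close> until the map is diagonal.

  There are \<open>3! \<sqdot> 4 = 24\<close> permutations with signs of product 1, which bounds the index. Such a map
  preserves the surface only if it preserves the linear form \<open>A x + B y + C z\<close>; if \<open>A, B, C\<close> are
  nonzero and have distinct squares, only the identity does.
\<close>

section \<open>The surface, its involutions, and words in them\<close>

text \<open>
  The cubic surface with the coefficients \<open>(A, B, C)\<close> collected in a vector \<open>k\<close>. Indexing the
  coordinates by the type \<open>3\<close> makes the symmetry under permutations of the coordinates explicit.
\<close>

definition surf :: "complex ^ 3 \<Rightarrow> complex \<Rightarrow> (complex ^ 3) set" where
  "surf k D = {v. (\<Sum>i\<in>UNIV. (v $ i)\<^sup>2) + (\<Prod>i\<in>UNIV. v $ i) = (\<Sum>i\<in>UNIV. k $ i * v $ i) + D}"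

text \<open>The involution that exchanges the two roots of the cubic equation in the \<open>i\<close>-th coordinate.\<close>

definition vieta :: "complex ^ 3 \<Rightarrow> 3 \<Rightarrow> complex ^ 3 \<Rightarrow> complex ^ 3" where
  "vieta k i v = (\<chi> j. if j = i then k $ i - v $ i - (\<Prod>l\<in>UNIV - {i}. v $ l) else v $ j)"

text \<open>A word acts by composition; its last letter is applied first.\<close>

fun word_act :: "complex ^ 3 \<Rightarrow> 3 list \<Rightarrow> complex ^ 3 \<Rightarrow> complex ^ 3" where
  "word_act k [] v = v"
| "word_act k (i # w) v = vieta k i (word_act k w v)"

text \<open>
  Permutations of the coordinates carry a surface of the family to the one with permuted
  coefficients, and permute the involutions accordingly.
\<close>

definition permute_coords :: "(3 \<Rightarrow> 3) \<Rightarrow> complex ^ 3 \<Rightarrow> complex ^ 3" where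
  "permute_coords \<pi> v = (\<chi> i. v $ \<pi> i)"

lemma UNIV_minus_3:
  "UNIV - {1 :: 3} = {2, 3}" "UNIV - {2 :: 3} = {1, 3}" "UNIV - {3 :: 3} = {1, 2}"
  by (simp_all add: set_eq_iff forall_3)

lemma vieta_simps:
  "vieta k 1 v = vector [k $ 1 - v $ 1 - v $ 2 * v $ 3, v $ 2, v $ 3]"
  "vieta k 2 v = vector [v $ 1, k $ 2 - v $ 2 - v $ 1 * v $ 3, v $ 3]"
  "vieta k 3 v = vector [v $ 1, v $ 2, k $ 3 - v $ 3 - v $ 1 * v $ 2]"
  unfolding vieta_def UNIV_minus_3 by (simp_all add: vec_eq_iff forall_3)

lemma prod_UNIV_3: "prod f (UNIV :: 3 set) = f 1 * f 2 * (f 3 :: complex)"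
  unfolding UNIV_3 by (simp add: mult.assoc)

lemma surf_iff:
  "v \<in> surf k D \<longleftrightarrow> (v $ 1)\<^sup>2 + (v $ 2)\<^sup>2 + (v $ 3)\<^sup>2 + v $ 1 * v $ 2 * v $ 3
     = k $ 1 * v $ 1 + k $ 2 * v $ 2 + k $ 3 * v $ 3 + D"
  by (simp add: surf_def sum_3 prod_UNIV_3 mult.assoc)

lemma cubic_surface_eq: "cubic_surface A B C D = surf (vector [A, B, C]) D"
  by (auto simp: cubic_surface_def surf_iff)

lemma vieta_vieta [simp]: "vieta k i (vieta k i v) = v"
  using exhaust_3[of i] by (auto simp: vieta_simps vec_eq_iff forall_3 algebra_simps)

lemma vieta_in_surf: "v \<in> surf k D \<Longrightarrow> vieta k i v \<in> surf k D"
proof -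
  have aux: "(p - x - m)\<^sup>2 + (p - x - m) * m - p * (p - x - m) = x\<^sup>2 + x * m - p * x"
    for p x m :: complex
    by (simp add: power2_eq_square algebra_simps)
  assume "v \<in> surf k D"
  then show ?thesis
    using exhaust_3[of i] aux[of "k $ 1" "v $ 1" "v $ 2 * v $ 3"]
      aux[of "k $ 2" "v $ 2" "v $ 1 * v $ 3"] aux[of "k $ 3" "v $ 3" "v $ 1 * v $ 2"]
    by (elim disjE; simp add: vieta_simps surf_iff power2_eq_square algebra_simps)
qed

lemma word_act_append: "word_act k (u @ w) v = word_act k u (word_act k w v)"
  by (induction u) auto

lemma word_act_in_surf: "v \<in> surf k D \<Longrightarrow> word_act k w v \<in> surf k D"
  by (induction w) (auto intro: vieta_in_surf)

lemma word_act_rev_act [simp]: "word_act k (rev w) (word_act k w v) = v"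
  by (induction w arbitrary: v) (auto simp: word_act_append)

lemma word_act_act_rev [simp]: "word_act k w (word_act k (rev w) v) = v"
  using word_act_rev_act[of k "rev w" v] by simp

lemma permute_coords_act:
  assumes "bij \<pi>"
  shows "word_act (permute_coords \<pi> k) w (permute_coords \<pi> v) = permute_coords \<pi> (word_act k (map \<pi> w) v)"
proof (induction w)
  case (Cons i w)
  have "(\<Prod>l\<in>UNIV - {i}. u $ \<pi> l) = (\<Prod>l\<in>UNIV - {\<pi> i}. u $ l)" for u :: "complex ^ 3"
  proof (rule prod.reindex_bij_betw)
    show "bij_betw \<pi> (UNIV - {i}) (UNIV - {\<pi> i})"
      using bij_betw_subset[OF assms, of "UNIV - {i}"] assms
      by (simp add: bij_def image_set_diff)
  qed
  then have "vieta (permute_coords \<pi> k) i (permute_coords \<pi> u) $ j = permute_coords \<pi> (vieta k (\<pi> i) u) $ j" for u j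
    using inj_eq[OF bij_is_inj[OF assms], of j i] by (simp add: vieta_def permute_coords_def)
  then have "vieta (permute_coords \<pi> k) i (permute_coords \<pi> u) = permute_coords \<pi> (vieta k (\<pi> i) u)" for u
    by (simp add: vec_eq_iff)
  with Cons show ?case by simp
qed simp

lemma permute_coords_in_surf:
  assumes "bij \<pi>" "v \<in> surf k D"
  shows "permute_coords \<pi> v \<in> surf (permute_coords \<pi> k) D"
proof -
  have "(\<Sum>i\<in>UNIV. (v $ \<pi> i)\<^sup>2) = (\<Sum>i\<in>UNIV. (v $ i)\<^sup>2)"
    by (rule sum.reindex_bij_betw[OF assms(1)])
  moreover have "(\<Sum>i\<in>UNIV. k $ \<pi> i * v $ \<pi> i) = (\<Sum>i\<in>UNIV. k $ i * v $ i)"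
    by (rule sum.reindex_bij_betw[OF assms(1)])
  moreover have "(\<Prod>i\<in>UNIV. v $ \<pi> i) = (\<Prod>i\<in>UNIV. v $ i)"
    by (rule prod.reindex_bij_betw[OF assms(1)])
  ultimately show ?thesis
    using assms(2) by (simp add: surf_def permute_coords_def)
qed

section \<open>Words in the matrix generators, and freeness by ping-pong\<close>

text \<open>The matrices \<open>s\<^sub>x, s\<^sub>y, s\<^sub>z\<close>.\<close>

definition gmat :: "3 \<Rightarrow> int ^ 2 ^ 2" where
  "gmat i = (vector [vector [vector [-1, 2], vector [0, 1]], vector [vector [1, 0], vector [2, -1]],
      vector [vector [1, 0], vector [0, -1]]] :: int ^ 2 ^ 2 ^ 3) $ i"

fun wmat :: "3 list \<Rightarrow> int ^ 2 ^ 2" where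
  "wmat [] = mat 1"
| "wmat (i # w) = gmat i ** wmat w"

lemma gmat_simps:
  "gmat 1 = vector [vector [-1, 2], vector [0, 1]]"
  "gmat 2 = vector [vector [1, 0], vector [2, -1]]"
  "gmat 3 = vector [vector [1, 0], vector [0, -1]]"
  by (simp_all add: gmat_def)

lemma gmat_gmat: "gmat i ** gmat i = mat 1"
  using exhaust_3[of i]
  by (auto simp: gmat_simps vec_eq_iff forall_2 matrix_matrix_mult_def sum_2 mat_def)

lemma gmat_gmat_left [simp]: "gmat i ** (gmat i ** M) = M"
  by (simp add: matrix_mul_assoc gmat_gmat)

lemma wmat_append: "wmat (u @ w) = wmat u ** wmat w"
  by (induction u) (auto simp: matrix_mul_assoc)

lemma wmat_rev: "wmat (rev w) ** wmat w = mat 1"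
proof (induction w)
  case (Cons i w)
  have "wmat (rev (i # w)) ** wmat (i # w) = wmat (rev w) ** (gmat i ** (gmat i ** wmat w))"
    by (simp only: rev.simps wmat_append wmat.simps matrix_mul_assoc matrix_mul_rid)
  then show ?case using Cons by simp
qed simp

lemma uminus_matrix_mult:
  fixes M N :: "int ^ 2 ^ 2"
  shows "(- M) ** N = - (M ** N)" "M ** (- N) = - (M ** N)"
  by (simp_all add: vec_eq_iff matrix_matrix_mult_def sum_2)

text \<open>
  Since every letter squares to the identity both as a matrix and as a map, cancelling equal
  neighbours changes neither of the two images of a word.
\<close>

lemma reduced_word:
  obtains r where "distinct_adj r" "wmat w = wmat r" "\<And>k v. word_act k w v = word_act k r v"
proof -
  have "\<exists>r. distinct_adj r \<and> wmat w = wmat r \<and> (\<forall>k v. word_act k w v = word_act k r v)"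
  proof (induction w)
    case Nil
    show ?case by (intro exI[of _ "[]"]) simp
  next
    case (Cons i w)
    then obtain r where r: "distinct_adj r" "wmat w = wmat r" "\<forall>k v. word_act k w v = word_act k r v" by blast
    show ?case
    proof (cases "r \<noteq> [] \<and> hd r = i")
      case True
      then obtain r' where "r = i # r'" by (cases r) auto
      with r show ?thesis by (intro exI[of _ r']) (auto simp: distinct_adj_Cons)
    next
      case False
      with r show ?thesis by (intro exI[of _ "i # r"]) (auto simp: distinct_adj_Cons)
    qed
  qed
  then show thesis using that by blast
qed

text \<open>
  \<open>P i u\<close> says that \<open>u\<close> lies in the region of the letter \<open>i\<close>, and \<open>h i u\<close> measures its size there. If
  a letter maps the regions of all other letters into its own and increases the size, then a
  reduced word whose last letter is not \<open>j\<close> increases the size of the points in the region of \<open>j\<close>.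
\<close>

lemma ping_pong:
  fixes h :: "'i \<Rightarrow> 'a \<Rightarrow> 'b :: linorder"
  assumes step: "\<And>i j u. P j u \<Longrightarrow> i \<noteq> j \<Longrightarrow> P i (s i u) \<and> h j u < h i (s i u)"
    and "P j u" "w \<noteq> []" "distinct_adj w" "last w \<noteq> j"
  shows "P (hd w) (foldr s w u) \<and> h j u < h (hd w) (foldr s w u)"
  using assms(3-5)
proof (induction w)
  case (Cons i w)
  show ?case
  proof (cases w)
    case Nil
    then show ?thesis using step[OF assms(2)] Cons.prems by simp
  next
    case (Cons i' w')
    then have IH: "P i' (foldr s w u)" "h j u < h i' (foldr s w u)" "i \<noteq> i'"
      using Cons.IH Cons.prems by auto
    then show ?thesis using step[OF IH(1,3)] by auto
  qed
qed simp

text \<open>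
  Three linear forms on \<open>\<int>\<^sup>2\<close>. Up to sign, the \<open>i\<close>-th generator fixes the two forms other than the
  \<open>i\<close>-th.
\<close>

definition lin :: "3 \<Rightarrow> int ^ 2 \<Rightarrow> int" where
  "lin i u = (vector [u $ 1, u $ 2, u $ 1 - u $ 2] :: int ^ 3) $ i"

lemma lin_simps: "lin 1 u = u $ 1" "lin 2 u = u $ 2" "lin 3 u = u $ 1 - u $ 2"
  by (simp_all add: lin_def)

definition lin_top :: "3 \<Rightarrow> int ^ 2 \<Rightarrow> bool" where
  "lin_top i u \<longleftrightarrow> (\<forall>j. j \<noteq> i \<longrightarrow> \<bar>lin j u\<bar> < \<bar>lin i u\<bar>)"

lemma lin_top_step:
  assumes "lin_top j u" "i \<noteq> j"
  shows "lin_top i (gmat i *v u) \<and> \<bar>lin j u\<bar> < \<bar>lin i (gmat i *v u)\<bar>"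
  using assms exhaust_3[of i] exhaust_3[of j]
  by (elim disjE; simp add: lin_top_def forall_3 lin_simps gmat_simps matrix_vector_mult_def sum_2;
      elim conjE; intro conjI; linarith)

lemma wmat_reduced_nontrivial:
  assumes w: "distinct_adj w" "w \<noteq> []"
  shows "wmat w \<noteq> mat 1 \<and> wmat w \<noteq> - mat 1"
proof -
  obtain j u where ju: "lin_top j u" "last w \<noteq> j"
  proof (cases "last w = 1")
    case True
    show thesis
      by (rule that[of 2 "vector [1, 2]"]) (simp_all add: True lin_top_def forall_3 lin_simps)
  next
    case False
    then show thesis
      by (intro that[of 1 "vector [2, 1]"]) (simp_all add: lin_top_def forall_3 lin_simps)
  qed
  have fw: "wmat w *v u = foldr (\<lambda>i u. gmat i *v u) w u" for u
    by (induction w) (simp_all flip: matrix_vector_mul_assoc)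
  have A: "lin_top (hd w) (wmat w *v u) \<and> \<bar>lin j u\<bar> < \<bar>lin (hd w) (wmat w *v u)\<bar>"
    unfolding fw by (rule ping_pong[where h = "\<lambda>i u. \<bar>lin i u\<bar>", OF lin_top_step ju(1) w(2,1) ju(2)])
  have B: "\<bar>lin i u\<bar> \<le> \<bar>lin j u\<bar>" for i using ju(1) by (cases "i = j") (auto simp: lin_top_def)
  have c: "\<bar>lin (hd w) (wmat w *v u)\<bar> \<noteq> \<bar>lin (hd w) u\<bar>"
    using A B[of "hd w"] by linarith
  have neg: "lin i ((- mat 1) *v u) = - lin i u" for i
    using exhaust_3[of i] by (elim disjE; simp add: lin_simps matrix_vector_mult_def sum_2 mat_def)
  show ?thesis
  proof
    show "wmat w \<noteq> mat 1" using c by (metis matrix_vector_mul_lid)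
    show "wmat w \<noteq> - mat 1" using c neg by (metis abs_minus_cancel)
  qed
qed

text \<open>
  The regions on the surface: all coordinates are large, and the \<open>i\<close>-th is strictly the largest. The
  bound \<open>K\<close> ensures that in \<open>k\<^sub>i - v\<^sub>i - v\<^sub>j v\<^sub>m\<close> the product dominates.
\<close>

definition big_top :: "real \<Rightarrow> 3 \<Rightarrow> complex ^ 3 \<Rightarrow> bool" where
  "big_top K i v \<longleftrightarrow> (\<forall>l. K \<le> norm (v $ l)) \<and> (\<forall>j. j \<noteq> i \<longrightarrow> norm (v $ j) < norm (v $ i))"

lemma big_top_step:
  assumes K: "\<And>i. 4 + norm (k $ i) \<le> K" and "big_top K j v" "i \<noteq> j"
  shows "big_top K i (vieta k i v) \<and> norm (v $ j) < norm (vieta k i v $ i)"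
proof -
  have *: "norm m < norm (a - x - m * n)"
    if "4 + norm a \<le> K" "norm x < norm m" "K \<le> norm m" "K \<le> norm n" for a x m n :: complex
  proof -
    have "4 \<le> norm n" using that norm_ge_zero[of a] by linarith
    then have "norm m * 4 \<le> norm m * norm n" by (intro mult_left_mono) auto
    moreover have "norm (m * n) \<le> norm (a - x - m * n) + norm a + norm x"
      using norm_triangle_ineq4[of "a - x" "a - x - m * n"] norm_triangle_ineq4[of a x] by simp
    moreover have "norm a \<le> norm m" using that by linarith
    ultimately show ?thesis using that(2) norm_ge_zero[of x] unfolding norm_mult by linarith
  qed
  have "norm (v $ j) < norm (vieta k i v $ i)"
  proof -
    \<comment> \<open>The third index.\<close>
    have "card (UNIV - {i} - {j}) = 1" using assms(3) by simp
    then obtain m where m: "UNIV - {i} - {j} = {m}" by (rule card_1_singletonE)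
    have "(\<Prod>l\<in>UNIV - {i}. v $ l) = v $ j * (\<Prod>l\<in>UNIV - {i} - {j}. v $ l)"
      using assms(3) by (intro prod.remove) auto
    then have "(\<Prod>l\<in>UNIV - {i}. v $ l) = v $ j * v $ m" unfolding m by simp
    then show ?thesis
      using *[of "k $ i" "v $ i" "v $ j" "v $ m"] assms by (simp add: vieta_def big_top_def)
  qed
  moreover have "big_top K i (vieta k i v)"
    unfolding big_top_def
  proof (intro conjI allI impI)
    fix l
    have le: "norm (v $ l) \<le> norm (v $ j)" "K \<le> norm (v $ l)" "K \<le> norm (v $ j)"
      using assms(2) by (cases "l = j"; force simp: big_top_def)+
    then show "K \<le> norm (vieta k i v $ l)"
      using \<open>norm (v $ j) < norm (vieta k i v $ i)\<close> by (cases "l = i") (auto simp: vieta_def)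
    assume "l \<noteq> i"
    then have "vieta k i v $ l = v $ l" by (simp add: vieta_def)
    with le show "norm (vieta k i v $ l) < norm (vieta k i v $ i)"
      using \<open>norm (v $ j) < norm (vieta k i v $ i)\<close> by simp
  qed
  ultimately show ?thesis by blast
qed

text \<open>
  For \<open>x = z = K\<close> the two values of \<open>y\<close> have sum \<open>k\<^sub>2 - K\<^sup>2\<close>, so one of them exceeds \<open>K\<close> in modulus.
\<close>

lemma big_top_point:
  assumes K: "\<And>i. 4 + norm (k $ i) \<le> K"
  shows "\<exists>v\<in>surf k D. big_top K 2 v"
proof -
  define x b c where "x = complex_of_real K" and "b = k $ 2 - x * x"
    and "c = x\<^sup>2 + x\<^sup>2 - k $ 1 * x - k $ 3 * x - D"
  define y where "y s = (b + s * csqrt (b\<^sup>2 - 4 * c)) / 2" for s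
  have sq: "2 * y s - b = s * csqrt (b\<^sup>2 - 4 * c)" for s by (simp add: y_def field_simps)
  have S: "vector [x, y s, x] \<in> surf k D" if "s\<^sup>2 = 1" for s
  proof -
    have "(2 * y s - b)\<^sup>2 = b\<^sup>2 - 4 * c" unfolding sq by (simp add: power_mult_distrib that)
    then have "4 * (y s)\<^sup>2 = 4 * (b * y s - c)" by (simp add: power2_eq_square algebra_simps)
    then have "(y s)\<^sup>2 = b * y s - c" by (simp only: mult_cancel_left) simp
    then show ?thesis by (simp add: surf_iff b_def c_def power2_eq_square algebra_simps)
  qed
  have "K \<ge> 4" using K[of 1] norm_ge_zero[of "k $ 1"] by linarith
  then have nx: "norm x = K" by (simp add: x_def)
  have "y 1 + y (-1) = b" by (simp add: y_def field_simps)
  then have "norm b \<le> norm (y 1) + norm (y (-1))" using norm_triangle_ineq[of "y 1" "y (-1)"] by simp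
  moreover have "norm (x * x) \<le> norm b + norm (k $ 2)"
    using norm_triangle_ineq4[of "k $ 2" b] by (simp add: b_def)
  moreover have "K * 4 \<le> norm (x * x)" using \<open>K \<ge> 4\<close> by (simp add: norm_mult nx)
  moreover have "norm (k $ 2) < K" using K[of 2] by linarith
  ultimately have "norm (y 1) > K \<or> norm (y (-1)) > K" using \<open>K \<ge> 4\<close> by linarith
  then obtain s where s: "s\<^sup>2 = 1" "norm (y s) > K" by (metis power2_minus power_one)
  then have "big_top K 2 (vector [x, y s, x])" by (simp add: big_top_def forall_3 nx)
  with S[OF s(1)] show ?thesis by blast
qed

lemma word_act_reduced_nontrivial:
  assumes w: "distinct_adj w" "w \<noteq> []"
  shows "\<exists>v\<in>surf k D. word_act k w v \<noteq> v"
proof -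
  define K where "K = 4 + (\<Sum>i\<in>UNIV. norm (k $ i))"
  have K: "4 + norm (k $ i) \<le> K" for i
    unfolding K_def by (intro add_left_mono member_le_sum) auto
  obtain j v where jv: "v \<in> surf k D" "big_top K j v" "last w \<noteq> j"
  proof (cases "last w = 2")
    case True
    let ?t = "Transposition.transpose 1 (2 :: 3)"
    have tt: "permute_coords ?t (permute_coords ?t v) = v" for v by (simp add: permute_coords_def vec_eq_iff)
    have "4 + norm (permute_coords ?t k $ i) \<le> K" for i using K by (simp add: permute_coords_def)
    then obtain v where v: "v \<in> surf (permute_coords ?t k) D" "big_top K 2 v"
      using big_top_point by blast
    have "permute_coords ?t v \<in> surf k D" using permute_coords_in_surf[OF _ v(1), of ?t] tt by simp
    moreover have "big_top K 1 (permute_coords ?t v)"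
      using v(2) by (simp add: big_top_def forall_3 permute_coords_def Transposition.transpose_def)
    ultimately show thesis by (rule that) (simp add: True)
  next
    case False
    then show thesis using big_top_point[OF K] that by blast
  qed
  have fw: "word_act k w v = foldr (vieta k) w v" for v by (induction w) simp_all
  have "big_top K (hd w) (word_act k w v) \<and> norm (v $ j) < norm (word_act k w v $ hd w)"
    unfolding fw
    by (rule ping_pong[where h = "\<lambda>i v. norm (v $ i)", OF big_top_step[OF K] jv(2) w(2,1) jv(3)])
  moreover have "norm (v $ i) \<le> norm (v $ j)" for i
    using jv(2) by (cases "i = j") (auto simp: big_top_def)
  ultimately have "word_act k w v \<noteq> v" by (metis not_le)
  then show ?thesis using jv(1) by blast
qed

lemma wmat_trivial_imp:
  assumes "wmat w = mat 1 \<or> wmat w = - mat 1"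
  shows "word_act k w v = v"
proof -
  obtain r where r: "distinct_adj r" "wmat w = wmat r" "\<And>k v. word_act k w v = word_act k r v"
    using reduced_word[of w] by blast
  then have "r = []" using assms wmat_reduced_nontrivial[of r] by auto
  with r(3) show ?thesis by simp
qed

lemma word_act_trivial_imp:
  assumes "\<And>v. v \<in> surf k D \<Longrightarrow> word_act k w v = v"
  shows "wmat w = mat 1"
proof -
  obtain r where r: "distinct_adj r" "wmat w = wmat r" "\<And>k v. word_act k w v = word_act k r v"
    using reduced_word[of w] by blast
  then have "r = []" using assms word_act_reduced_nontrivial[of r k D] by auto
  with r(2) show ?thesis by simp
qed

section \<open>Generation by the Euclidean algorithm\<close>

definition mat2 :: "int \<Rightarrow> int \<Rightarrow> int \<Rightarrow> int \<Rightarrow> int ^ 2 ^ 2" where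
  "mat2 a b c d = vector [vector [a, b], vector [c, d]]"

lemma gmat_mat2:
  "gmat 1 ** mat2 a b c d = mat2 (2 * c - a) (2 * d - b) c d"
  "gmat 2 ** mat2 a b c d = mat2 a b (2 * a - c) (2 * b - d)"
  "gmat 3 ** mat2 a b c d = mat2 a b (- c) (- d)"
  by (simp_all add: mat2_def gmat_simps vec_eq_iff forall_2 matrix_matrix_mult_def sum_2)

definition word_generated :: "int ^ 2 ^ 2 \<Rightarrow> bool" where
  "word_generated M \<longleftrightarrow> (\<exists>w. M = wmat w \<or> M = - wmat w)"

lemma generated_gmat: "word_generated (gmat i ** M) \<Longrightarrow> word_generated M"
proof -
  assume "word_generated (gmat i ** M)"
  then obtain w where "gmat i ** M = wmat w \<or> gmat i ** M = - wmat w"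
    by (auto simp: word_generated_def)
  then have "gmat i ** (gmat i ** M) = wmat (i # w) \<or> gmat i ** (gmat i ** M) = - wmat (i # w)"
    by (metis uminus_matrix_mult(2) wmat.simps(2))
  then show "word_generated M" unfolding word_generated_def gmat_gmat_left by blast
qed

lemma generated_upper:
  assumes "\<bar>a\<bar> = 1" "\<bar>d\<bar> = 1" "even b"
  shows "word_generated (mat2 a b 0 d)"
  using assms
proof (induction "nat \<bar>b\<bar>" arbitrary: a b d rule: less_induct)
  case less
  obtain b' where b': "b = 2 * b'" using less.prems(3) by (rule evenE)
  have ad: "a = 1 \<or> a = -1" "d = 1 \<or> d = -1" using less.prems by linarith+
  have "\<bar>2 * d - b\<bar> < \<bar>b\<bar> \<or> \<bar>- 2 * d - b\<bar> < \<bar>b\<bar>" if "b \<noteq> 0"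
  proof (cases "b > 0")
    case True
    then have "b \<ge> 2" using b' by presburger
    then show ?thesis using ad(2) by auto
  next
    case False
    then have "b \<le> -2" using b' that by presburger
    then show ?thesis using ad(2) by auto
  qed
  then consider "b = 0" | "b \<noteq> 0" "\<bar>2 * d - b\<bar> < \<bar>b\<bar>" | "b \<noteq> 0" "\<bar>- 2 * d - b\<bar> < \<bar>b\<bar>"
    by blast
  then show ?case
  proof cases
    case 1
    have "mat2 a b 0 d \<in> {wmat [], - wmat [], wmat [3], - wmat [3]}"
      using ad 1 by (elim disjE; simp add: mat2_def gmat_simps vec_eq_iff forall_2 mat_def
          matrix_matrix_mult_def sum_2)
    then show ?thesis unfolding word_generated_def by blast
  next
    case 2
    then have "word_generated (mat2 (- a) (2 * d - b) 0 d)"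
      using less.prems by (intro less.hyps) auto
    then have "word_generated (gmat 1 ** mat2 a b 0 d)" by (simp add: gmat_mat2)
    then show ?thesis by (rule generated_gmat)
  next
    case 3
    then have "word_generated (mat2 (- a) (- 2 * d - b) 0 (- d))"
      using less.prems by (intro less.hyps) auto
    then have "word_generated (gmat 1 ** (gmat 3 ** mat2 a b 0 d))" by (simp add: gmat_mat2)
    then have "word_generated (gmat 3 ** mat2 a b 0 d)" by (rule generated_gmat)
    then show ?thesis by (rule generated_gmat)
  qed
qed

text \<open>
  Reduction of the first column \<open>(a, c)\<close>: unless \<open>c = 0\<close>, the largest of \<open>\<bar>a\<bar>, \<bar>c\<bar>, \<bar>a - c\<bar>\<close> is the sum
  of the other two; all three are nonzero because \<open>a\<close> is odd and \<open>c\<close> is even, and the corresponding generator replaces it by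
  the absolute value of their difference.
\<close>

lemma generated_mat2:
  assumes "\<bar>a * d - b * c\<bar> = 1" "odd a" "even b" "even c" "odd d"
  shows "word_generated (mat2 a b c d)"
  using assms
proof (induction "nat (\<bar>a\<bar> + \<bar>c\<bar> + \<bar>a - c\<bar>)" arbitrary: a b c d rule: less_induct)
  case less
  have "a \<noteq> 0" "a \<noteq> c" using less.prems by auto
  then consider "c = 0" | "\<bar>2 * c - a\<bar> < \<bar>a\<bar>" | "\<bar>2 * a - c\<bar> < \<bar>c\<bar>" | "\<bar>a + c\<bar> < \<bar>a - c\<bar>"
    by linarith
  then show ?case
  proof cases
    case 1
    then have "\<bar>a\<bar> = 1" "\<bar>d\<bar> = 1" using less.prems by (auto simp: abs_mult zmult_eq_1_iff)
    then show ?thesis using generated_upper less.prems 1 by simp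
  next
    case 2
    have "(2 * c - a) * d - (2 * d - b) * c = - (a * d - b * c)" by (simp add: algebra_simps)
    then have "\<bar>(2 * c - a) * d - (2 * d - b) * c\<bar> = 1" using less.prems(1) by linarith
    then have "word_generated (mat2 (2 * c - a) (2 * d - b) c d)"
      using less.prems 2 by (intro less.hyps) auto
    then show ?thesis using generated_gmat[of 1 "mat2 a b c d"] by (simp add: gmat_mat2)
  next
    case 3
    have "a * (2 * b - d) - b * (2 * a - c) = - (a * d - b * c)" by (simp add: algebra_simps)
    then have "\<bar>a * (2 * b - d) - b * (2 * a - c)\<bar> = 1" using less.prems(1) by linarith
    then have "word_generated (mat2 a b (2 * a - c) (2 * b - d))"
      using less.prems 3 by (intro less.hyps) auto
    then show ?thesis using generated_gmat[of 2 "mat2 a b c d"] by (simp add: gmat_mat2)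
  next
    case 4
    have "a * (- d) - b * (- c) = - (a * d - b * c)" by (simp add: algebra_simps)
    then have "\<bar>a * (- d) - b * (- c)\<bar> = 1" using less.prems(1) by linarith
    then have "word_generated (mat2 a b (- c) (- d))"
      using less.prems 4 by (intro less.hyps) auto
    then show ?thesis using generated_gmat[of 3 "mat2 a b c d"] by (simp add: gmat_mat2)
  qed
qed

section \<open>Normal forms of regular functions and their norms\<close>

text \<open>
  Polynomials in \<open>x\<close> and \<open>z\<close> are polynomials in \<open>x\<close> over \<open>\<complex>[z]\<close>, so that their degree is the degree in \<open>x\<close>.
\<close>

definition poly2 :: "complex poly poly \<Rightarrow> complex \<Rightarrow> complex \<Rightarrow> complex" where
  "poly2 p x z = poly (poly p [:x:]) z"

lemma poly2_simps [simp]: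
  "poly2 0 x z = 0" "poly2 1 x z = 1" "poly2 (p + q) x z = poly2 p x z + poly2 q x z"
  "poly2 (- p) x z = - poly2 p x z" "poly2 (p - q) x z = poly2 p x z - poly2 q x z"
  "poly2 (p * q) x z = poly2 p x z * poly2 q x z" "poly2 (p ^ n) x z = poly2 p x z ^ n"
  "poly2 (pCons c p) x z = poly c z + x * poly2 p x z"
  by (simp_all add: poly2_def)

lemma poly2_eq_0_imp:
  assumes "\<And>x z. poly2 p x z = 0"
  shows "p = 0"
proof (rule ccontr)
  assume "p \<noteq> 0"
  have "poly p [:x:] = 0" for x
    using assms by (simp add: poly2_def poly_all_0_iff_0[symmetric])
  then have "range (\<lambda>x. [:x:]) \<subseteq> {r. poly p r = 0}" by auto
  then have "finite (range (\<lambda>x :: complex. [:x:]))"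
    using poly_roots_finite[OF \<open>p \<noteq> 0\<close>] finite_subset by blast
  then show False
    using finite_imageD[of "\<lambda>x :: complex. [:x:]" UNIV] infinite_UNIV_char_0
    by (auto simp: inj_on_def)
qed

text \<open>
  Modulo the equation of the surface every polynomial has a normal form \<open>p(x, z) + q(x, z) y\<close>, because
  the equation is monic and quadratic in \<open>y\<close>: it reads \<open>y\<^sup>2 = y_trace y - y_norm\<close>.
\<close>

definition represents :: "complex ^ 3 \<Rightarrow> complex \<Rightarrow> (complex ^ 3 \<Rightarrow> complex)
    \<Rightarrow> complex poly poly \<Rightarrow> complex poly poly \<Rightarrow> bool" where
  "represents k D f p q \<longleftrightarrow>
    (\<forall>v\<in>surf k D. f v = poly2 p (v $ 1) (v $ 3) + poly2 q (v $ 1) (v $ 3) * v $ 2)"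

definition y_trace :: "complex ^ 3 \<Rightarrow> complex poly poly" where
  "y_trace k = [:[:k $ 2:], [:0, -1:]:]"

definition y_norm :: "complex ^ 3 \<Rightarrow> complex \<Rightarrow> complex poly poly" where
  "y_norm k D = [:[:- D, - k $ 3, 1:], [:- k $ 1:], 1:]"

text \<open>
  The norm to \<open>\<complex>[x, z]\<close> of \<open>p + q y\<close>, that is, its product with its conjugate under the involution in \<open>y\<close>.
\<close>

definition norm_poly :: "complex ^ 3 \<Rightarrow> complex \<Rightarrow> complex poly poly \<Rightarrow> complex poly poly
    \<Rightarrow> complex poly poly" where
  "norm_poly k D p q = p\<^sup>2 + p * q * y_trace k + q\<^sup>2 * y_norm k D"

lemma poly2_y_trace: "poly2 (y_trace k) x z = k $ 2 - x * z"
  by (simp add: y_trace_def)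

lemma poly2_y_norm: "poly2 (y_norm k D) x z = x\<^sup>2 + z\<^sup>2 - k $ 1 * x - k $ 3 * z - D"
  by (simp add: y_norm_def algebra_simps power2_eq_square)

lemma surf_quadratic:
  "v \<in> surf k D \<longleftrightarrow>
    (v $ 2)\<^sup>2 = poly2 (y_trace k) (v $ 1) (v $ 3) * v $ 2 - poly2 (y_norm k D) (v $ 1) (v $ 3)"
  unfolding surf_iff poly2_y_trace poly2_y_norm by (simp add: algebra_simps)

lemma surf_point_over:
  obtains v where "v \<in> surf k D" "v $ 1 = x" "v $ 3 = z"
proof -
  define b c where "b = poly2 (y_trace k) x z" and "c = poly2 (y_norm k D) x z"
  define y where "y = (b + csqrt (b\<^sup>2 - 4 * c)) / 2"
  have "2 * y - b = csqrt (b\<^sup>2 - 4 * c)" by (simp add: y_def field_simps)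
  then have "(2 * y - b)\<^sup>2 = b\<^sup>2 - 4 * c" by simp
  then have "4 * y\<^sup>2 = 4 * (b * y - c)" by (simp add: power2_eq_square algebra_simps)
  then have "y\<^sup>2 = b * y - c" by (simp only: mult_cancel_left) simp
  then have "vector [x, y, z] \<in> surf k D"
    by (simp add: surf_quadratic b_def c_def)
  then show thesis by (rule that) simp_all
qed

lemma norm_poly_eq:
  assumes "represents k D f p q" "v \<in> surf k D"
  shows "f v * f (vieta k 2 v) = poly2 (norm_poly k D p q) (v $ 1) (v $ 3)"
proof -
  define P Q t n where "P = poly2 p (v $ 1) (v $ 3)" and "Q = poly2 q (v $ 1) (v $ 3)"
    and "t = poly2 (y_trace k) (v $ 1) (v $ 3)" and "n = poly2 (y_norm k D) (v $ 1) (v $ 3)"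
  note defs = this
  have f: "f v = P + Q * v $ 2" "f (vieta k 2 v) = P + Q * (t - v $ 2)"
    using assms vieta_in_surf[OF assms(2), of 2]
    by (auto simp: represents_def vieta_simps defs poly2_y_trace)
  have "(v $ 2)\<^sup>2 = t * v $ 2 - n" using assms(2) by (simp add: surf_quadratic defs)
  then have "(P + Q * v $ 2) * (P + Q * (t - v $ 2)) = P\<^sup>2 + P * Q * t + Q\<^sup>2 * n"
    by (simp add: power2_eq_square algebra_simps) algebra?
  then show ?thesis unfolding f norm_poly_def by (simp add: defs)
qed

lemma coeff_mult_at_bounds:
  assumes "degree p \<le> m" "degree q \<le> n"
  shows "coeff (p * q) (m + n) = coeff p m * coeff (q :: 'a :: comm_semiring_0 poly) n"
proof -
  have "coeff p i * coeff q (m + n - i) = (if i = m then coeff p m * coeff q n else 0)"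
    if "i \<le> m + n" for i
  proof (cases i m rule: linorder_cases)
    case less
    then have "n < m + n - i" using that by linarith
    then have "coeff q (m + n - i) = 0" using assms(2) by (intro coeff_eq_0) linarith
    then show ?thesis using less by simp
  next
    case greater
    then have "coeff p i = 0" using assms(1) by (intro coeff_eq_0) linarith
    then show ?thesis using greater by simp
  qed simp
  then show ?thesis by (simp add: coeff_mult)
qed

text \<open>Otherwise \<open>z - 2\<close> would divide the right-hand side with odd and the left-hand side with even multiplicity.\<close>

lemma z_sq_minus_4_nonsquare:
  fixes u w :: "complex poly"
  assumes "u\<^sup>2 = [:-4, 0, 1:] * w\<^sup>2"
  shows "w = 0"
proof (rule ccontr)
  assume "w \<noteq> 0"
  have f: "[:-4, 0, 1:] = [:-2, 1:] * ([:2, 1:] :: complex poly)" by simp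
  have nz: "[:-2, 1:] * [:2, 1:] * w\<^sup>2 \<noteq> 0"
    using \<open>w \<noteq> 0\<close> by (metis mult_eq_0_iff pCons_eq_0_iff power_eq_0_iff zero_neq_one)
  have "u \<noteq> 0"
  proof
    assume "u = 0"
    then show False using nz assms[symmetric] unfolding f by (simp only: zero_power2 simp_thms)
  qed
  have "Polynomial.order 2 [:2, 1 :: complex:] = 0" by (rule order_0I) simp
  moreover have "Polynomial.order 2 [:-2, 1 :: complex:] = 1"
    using order_power_n_n[of "2 :: complex" 1] by simp
  moreover have "Polynomial.order 2 (u\<^sup>2) = Polynomial.order 2 u + Polynomial.order 2 u"
    using \<open>u \<noteq> 0\<close> by (simp add: power2_eq_square order_mult)
  moreover have "Polynomial.order 2 (w\<^sup>2) = Polynomial.order 2 w + Polynomial.order 2 w"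
    using \<open>w \<noteq> 0\<close> by (simp add: power2_eq_square order_mult)
  moreover have "Polynomial.order 2 (u\<^sup>2)
      = Polynomial.order 2 [:-2, 1 :: complex:] + Polynomial.order 2 [:2, 1 :: complex:]
        + Polynomial.order 2 (w\<^sup>2)"
    unfolding assms f using nz by (metis order_mult mult_eq_0_iff)
  ultimately show False by presburger
qed

text \<open>The quadratic form \<open>a\<^sup>2 - z a b + b\<^sup>2\<close>, of discriminant \<open>z\<^sup>2 - 4\<close>, has no nontrivial zero over \<open>\<complex>[z]\<close>.\<close>

lemma anisotropic:
  fixes a b :: "complex poly"
  assumes "a\<^sup>2 - [:0, 1:] * a * b + b\<^sup>2 = 0"
  shows "a = 0 \<and> b = 0"
proof -
  have "(2 * a - [:0, 1:] * b)\<^sup>2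
      = 4 * (a\<^sup>2 - [:0, 1:] * a * b + b\<^sup>2) + ([:0, 1:]\<^sup>2 - 4) * b\<^sup>2"
    by (simp only: power2_eq_square) algebra
  also have "[:0, 1:]\<^sup>2 - 4 = ([:-4, 0, 1:] :: complex poly)"
    by (simp add: power2_eq_square numeral_poly)
  finally have "(2 * a - [:0, 1:] * b)\<^sup>2 = [:-4, 0, 1:] * b\<^sup>2"
    unfolding assms by (simp only: mult_zero_right add_0)
  then have "b = 0" by (rule z_sq_minus_4_nonsquare)
  then show ?thesis using assms by simp
qed

text \<open>
  The degree of \<open>p(x, z) + q(x, z) y\<close> in \<open>x\<close> and \<open>y\<close>. The polynomial \<open>pCons 0 q\<close> is \<open>x q\<close>; using it in
  place of \<open>deg q + 1\<close> gives the right value 0 when \<open>q = 0\<close>.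
\<close>

definition rep_degree :: "complex poly poly \<Rightarrow> complex poly poly \<Rightarrow> nat" where
  "rep_degree p q = max (degree p) (degree (pCons 0 q))"

text \<open>
  With \<open>n\<close> the degree of \<open>p + q y\<close>, the coefficient of \<open>x\<^bsup>2n\<^esup>\<close> in the norm is the anisotropic form
  evaluated at the coefficients of degree \<open>n\<close> of \<open>p\<close> and \<open>x q\<close>; it does not vanish.
\<close>

lemma norm_poly_degree:
  assumes "p \<noteq> 0 \<or> q \<noteq> 0"
  shows "norm_poly k D p q \<noteq> 0" "degree (norm_poly k D p q) = 2 * rep_degree p q"
proof -
  define n where "n = rep_degree p q"
  \<comment> \<open>In \<open>p\<^sup>2 + p (q y_trace) + q\<^sup>2 y_norm\<close> the three terms have degree at most \<open>2n\<close>.\<close>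
  define q1 where "q1 = pCons 0 q"
  have dp: "degree p \<le> n" and dq: "degree q1 \<le> n" by (auto simp: n_def rep_degree_def q1_def)
  have dqt: "degree (q * y_trace k) \<le> n"
  proof (cases "q = 0")
    case False
    have "degree (q * y_trace k) \<le> degree q + 1"
      by (rule order_trans[OF degree_mult_le]) (simp add: y_trace_def)
    then show ?thesis using dq False by (simp add: q1_def)
  qed simp
  have cqt: "coeff (q * y_trace k) n = - [:0, 1:] * coeff q1 n"
  proof (cases "q = 0")
    case False
    then have "degree q \<le> n - 1" "n = n - 1 + 1" using dq by (auto simp: q1_def)
    then have "coeff (q * y_trace k) n = coeff q (n - 1) * coeff (y_trace k) 1"
      using coeff_mult_at_bounds[of q "n - 1" "y_trace k" 1] by (simp add: y_trace_def)
    also have "coeff (y_trace k) 1 = - [:0, 1:]" by (simp add: y_trace_def)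
    finally show ?thesis using \<open>n = n - 1 + 1\<close>
      by (metis coeff_pCons_Suc q1_def Suc_eq_plus1 mult.commute)
  qed (simp add: q1_def)
  have dqn: "degree (q\<^sup>2 * y_norm k D) \<le> n + n" and cqn: "coeff (q\<^sup>2 * y_norm k D) (n + n) = (coeff q1 n)\<^sup>2"
  proof -
    have "degree (q\<^sup>2 * y_norm k D) \<le> n + n \<and> coeff (q\<^sup>2 * y_norm k D) (n + n) = (coeff q1 n)\<^sup>2"
    proof (cases "q = 0")
      case False
      then have d: "degree q \<le> n - 1" "n = Suc (n - 1)" using dq by (auto simp: q1_def)
      have d2: "degree (q * q) \<le> (n - 1) + (n - 1)"
        using degree_mult_le[of q q] d by linarith
      have dn: "degree (y_norm k D) \<le> 2" by (simp add: y_norm_def)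
      have "coeff (y_norm k D) 2 = 1" by (simp add: y_norm_def numeral_2_eq_2)
      then have "coeff (q\<^sup>2 * y_norm k D) ((n - 1) + (n - 1) + 2) = coeff q (n - 1) * coeff q (n - 1)"
        using coeff_mult_at_bounds[OF d2 dn] coeff_mult_at_bounds[OF d(1) d(1)]
        by (simp add: power2_eq_square)
      moreover have e: "(n - 1) + (n - 1) + 2 = n + n" using d(2) by linarith
      moreover have "coeff q1 n = coeff q (n - 1)" by (metis coeff_pCons_Suc q1_def d(2))
      moreover have "degree (q\<^sup>2 * y_norm k D) \<le> (n - 1) + (n - 1) + 2"
        using degree_mult_le[of "q\<^sup>2" "y_norm k D"] d2 dn by (simp add: power2_eq_square)
      ultimately show ?thesis unfolding e by (simp only: power2_eq_square simp_thms)
    qed (simp add: q1_def)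
    then show "degree (q\<^sup>2 * y_norm k D) \<le> n + n" "coeff (q\<^sup>2 * y_norm k D) (n + n) = (coeff q1 n)\<^sup>2"
      by auto
  qed
  have np: "norm_poly k D p q = p * p + p * (q * y_trace k) + q\<^sup>2 * y_norm k D"
    by (simp add: norm_poly_def power2_eq_square mult.assoc)
  have "coeff (norm_poly k D p q) (n + n)
      = (coeff p n)\<^sup>2 - [:0, 1:] * coeff p n * coeff q1 n + (coeff q1 n)\<^sup>2"
    unfolding np coeff_add coeff_mult_at_bounds[OF dp dp] coeff_mult_at_bounds[OF dp dqt] cqt cqn
    by (simp add: power2_eq_square algebra_simps)
  moreover have "coeff p n \<noteq> 0 \<or> coeff q1 n \<noteq> 0"
  proof (cases "n = degree p \<and> p \<noteq> 0")
    case True then show ?thesis by simp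
  next
    case False
    have n: "n = max (degree p) (degree q1)" by (simp add: n_def rep_degree_def q1_def)
    have "q \<noteq> 0"
    proof
      assume "q = 0"
      then have "p \<noteq> 0" "n = degree p" using assms n by (simp_all add: q1_def)
      with False show False by simp
    qed
    then have "degree q1 > 0" "q1 \<noteq> 0" by (simp_all add: q1_def)
    moreover have "n = degree q1"
    proof (rule ccontr)
      assume "n \<noteq> degree q1"
      then have "n = degree p" "n > 0" using n \<open>degree q1 > 0\<close> by linarith+
      with False show False by force
    qed
    ultimately have "coeff q1 n \<noteq> 0" by simp
    then show ?thesis ..
  qed
  ultimately have nz: "coeff (norm_poly k D p q) (n + n) \<noteq> 0"
    using anisotropic[of "coeff p n" "coeff q1 n"] by auto
  then show "norm_poly k D p q \<noteq> 0" by auto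
  have "degree (norm_poly k D p q) \<le> n + n"
    unfolding np
  proof (intro degree_add_le)
    show "degree (p * p) \<le> n + n" using degree_mult_le[of p p] dp by linarith
    show "degree (p * (q * y_trace k)) \<le> n + n"
      using degree_mult_le[of p "q * y_trace k"] dp dqt by linarith
  qed (rule dqn)
  then show "degree (norm_poly k D p q) = 2 * rep_degree p q"
    using le_degree[OF nz] by (simp add: n_def)
qed

section \<open>The ring of regular functions and its degree along the conics\<close>

text \<open>
  The regular functions on the surface. Only the values on the surface matter, and the normal form is
  unique there.
\<close>

definition regular :: "complex ^ 3 \<Rightarrow> complex \<Rightarrow> (complex ^ 3 \<Rightarrow> complex) \<Rightarrow> bool" where
  "regular k D f \<longleftrightarrow> (\<exists>p q. represents k D f p q)"

definition vanishes :: "complex ^ 3 \<Rightarrow> complex \<Rightarrow> (complex ^ 3 \<Rightarrow> complex) \<Rightarrow> bool" where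
  "vanishes k D f \<longleftrightarrow> (\<forall>v\<in>surf k D. f v = 0)"

lemma represents_vanishes:
  assumes "represents k D f p q" "vanishes k D f"
  shows "p = 0 \<and> q = 0"
proof -
  have "norm_poly k D p q = 0"
  proof (rule poly2_eq_0_imp)
    fix x z
    obtain v where v: "v \<in> surf k D" "v $ 1 = x" "v $ 3 = z" by (rule surf_point_over)
    with norm_poly_eq[OF assms(1) v(1)] assms(2) show "poly2 (norm_poly k D p q) x z = 0"
      by (auto simp: vanishes_def)
  qed
  then show ?thesis using norm_poly_degree(1) by blast
qed

lemma represents_diff:
  "represents k D f p q \<Longrightarrow> represents k D g p' q' \<Longrightarrow> represents k D (\<lambda>v. f v - g v) (p - p') (q - q')"
  by (simp add: represents_def algebra_simps)

lemma represents_unique: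
  assumes "represents k D f p q" "represents k D f p' q'"
  shows "p = p' \<and> q = q'"
  using represents_vanishes[OF represents_diff[OF assms]] by (simp add: vanishes_def)

lemma represents_mult:
  assumes "represents k D f p q" "represents k D g p' q'"
  shows "represents k D (\<lambda>v. f v * g v) (p * p' - q * q' * y_norm k D) (p * q' + q * p' + q * q' * y_trace k)"
  unfolding represents_def
proof
  fix v assume v: "v \<in> surf k D"
  have aux: "(P + Q * y) * (P' + Q' * y) = P * P' - Q * Q' * n + (P * Q' + Q * P' + Q * Q' * t) * y"
    if "y\<^sup>2 = t * y - n" for P Q P' Q' y t n :: complex
  proof -
    have "(P + Q * y) * (P' + Q' * y) = P * P' + (P * Q' + Q * P') * y + Q * Q' * y\<^sup>2"
      by (simp add: algebra_simps power2_eq_square)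
    then show ?thesis unfolding that by (simp add: algebra_simps)
  qed
  have "f v = poly2 p (v $ 1) (v $ 3) + poly2 q (v $ 1) (v $ 3) * v $ 2"
    "g v = poly2 p' (v $ 1) (v $ 3) + poly2 q' (v $ 1) (v $ 3) * v $ 2"
    using assms v by (auto simp: represents_def)
  then show "f v * g v = poly2 (p * p' - q * q' * y_norm k D) (v $ 1) (v $ 3)
      + poly2 (p * q' + q * p' + q * q' * y_trace k) (v $ 1) (v $ 3) * v $ 2"
    using aux[OF v[unfolded surf_quadratic]] by simp
qed

lemma regular_cong: "(\<And>v. v \<in> surf k D \<Longrightarrow> f v = g v) \<Longrightarrow> regular k D f \<longleftrightarrow> regular k D g"
  by (simp add: regular_def represents_def)

lemma regular_const [intro, simp]: "regular k D (\<lambda>v. c)"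
proof -
  have "represents k D (\<lambda>v. c) [:[:c:]:] 0" by (simp add: represents_def)
  then show ?thesis unfolding regular_def by blast
qed

lemma represents_coords:
  "represents k D (\<lambda>v. v $ 1) [:0, 1:] 0" "represents k D (\<lambda>v. v $ 2) 0 1" "represents k D (\<lambda>v. v $ 3) [:[:0, 1:]:] 0"
  by (simp_all add: represents_def)

lemma regular_coord [intro, simp]: "regular k D (\<lambda>v. v $ i)"
  using exhaust_3[of i] represents_coords unfolding regular_def by metis

lemma regular_add [intro, simp]: "regular k D f \<Longrightarrow> regular k D g \<Longrightarrow> regular k D (\<lambda>v. f v + g v)"
proof -
  have "represents k D (\<lambda>v. f v + g v) (p + p') (q + q')"
    if "represents k D f p q" "represents k D g p' q'" for p q p' q'
    using that by (simp add: represents_def algebra_simps)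
  then show "regular k D f \<Longrightarrow> regular k D g \<Longrightarrow> regular k D (\<lambda>v. f v + g v)" unfolding regular_def by blast
qed

lemma regular_diff [intro, simp]: "regular k D f \<Longrightarrow> regular k D g \<Longrightarrow> regular k D (\<lambda>v. f v - g v)"
  unfolding regular_def using represents_diff by blast

lemma regular_mult [intro, simp]: "regular k D f \<Longrightarrow> regular k D g \<Longrightarrow> regular k D (\<lambda>v. f v * g v)"
  unfolding regular_def using represents_mult by blast

lemma regular_power [intro, simp]: "regular k D f \<Longrightarrow> regular k D (\<lambda>v. f v ^ n)"
  by (induction n) auto

lemma regular_poly [intro, simp]: "regular k D f \<Longrightarrow> regular k D (\<lambda>v. poly a (f v))"
  by (induction a) auto

lemma regular_poly2 [intro, simp]: "regular k D f \<Longrightarrow> regular k D g \<Longrightarrow> regular k D (\<lambda>v. poly2 p (f v) (g v))"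
  by (induction p) auto

lemma regular_polynomial_function: "complex_polynomial_function f \<Longrightarrow> regular k D f"
  by (induction rule: complex_polynomial_function.induct) auto

lemma regular_compose:
  assumes f: "regular k' D' f" and \<phi>: "\<And>i. regular k D (\<lambda>v. \<phi> v $ i)"
    and maps: "\<And>v. v \<in> surf k D \<Longrightarrow> \<phi> v \<in> surf k' D'"
  shows "regular k D (\<lambda>v. f (\<phi> v))"
proof -
  obtain p q where "represents k' D' f p q" using f unfolding regular_def by blast
  then have "f (\<phi> v) = poly2 p (\<phi> v $ 1) (\<phi> v $ 3) + poly2 q (\<phi> v $ 1) (\<phi> v $ 3) * \<phi> v $ 2"
    if "v \<in> surf k D" for v
    using maps[OF that] by (auto simp: represents_def)
  then show ?thesis
    using \<phi> by (subst regular_cong) auto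
qed

lemma regular_vieta: "(\<And>i. regular k' D' (\<lambda>v. \<phi> v $ i)) \<Longrightarrow> regular k' D' (\<lambda>v. vieta k i (\<phi> v) $ j)"
  using exhaust_3[of i] exhaust_3[of j] by (auto simp: vieta_simps)

text \<open>
  The degree of a regular function along the conics \<open>z = const\<close>, equal to 0 for the zero function.
\<close>

definition fdeg :: "complex ^ 3 \<Rightarrow> complex \<Rightarrow> (complex ^ 3 \<Rightarrow> complex) \<Rightarrow> nat" where
  "fdeg k D f = (THE d. \<exists>p q. represents k D f p q \<and> d = rep_degree p q)"

lemma fdeg_rep: "represents k D f p q \<Longrightarrow> fdeg k D f = rep_degree p q"
  unfolding fdeg_def using represents_unique by blast

lemma fdeg_cong: "(\<And>v. v \<in> surf k D \<Longrightarrow> f v = g v) \<Longrightarrow> fdeg k D f = fdeg k D g"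
proof -
  assume "\<And>v. v \<in> surf k D \<Longrightarrow> f v = g v"
  then have "represents k D f p q \<longleftrightarrow> represents k D g p q" for p q by (simp add: represents_def)
  then show ?thesis by (simp add: fdeg_def)
qed

lemma fdeg_add_le:
  assumes "regular k D f" "regular k D g" "fdeg k D f \<le> n" "fdeg k D g \<le> n"
  shows "fdeg k D (\<lambda>v. f v + g v) \<le> n"
proof -
  obtain p q p' q' where r: "represents k D f p q" "represents k D g p' q'" using assms unfolding regular_def by blast
  have "represents k D (\<lambda>v. f v + g v) (p + p') (q + q')"
    using r by (simp add: represents_def algebra_simps)
  from fdeg_rep[OF this] fdeg_rep[OF r(1)] fdeg_rep[OF r(2)] assms(3,4)
  show ?thesis
    using degree_add_le[of p n p'] degree_add_le[of "pCons 0 q" n "pCons 0 q'"] by (simp add: rep_degree_def)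
qed

lemma fdeg_vanishes: "vanishes k D f \<Longrightarrow> fdeg k D f = 0"
  using fdeg_rep[of k D f 0 0] by (simp add: represents_def vanishes_def rep_degree_def)

lemma fdeg_const [simp]: "fdeg k D (\<lambda>v. c) = 0"
  using fdeg_rep[of k D "\<lambda>v. c" "[:[:c:]:]" 0] by (simp add: represents_def rep_degree_def)

lemma fdeg_coords [simp]:
  "fdeg k D (\<lambda>v. v $ 1) = 1" "fdeg k D (\<lambda>v. v $ 2) = 1" "fdeg k D (\<lambda>v. v $ 3) = 0"
  using represents_coords[of k D, THEN fdeg_rep] by (simp_all add: rep_degree_def)

text \<open>The degree is half the degree of the norm, which is multiplicative.\<close>

lemma fdeg_mult:
  assumes "regular k D f" "regular k D g" "\<not> vanishes k D f" "\<not> vanishes k D g"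
  shows "\<not> vanishes k D (\<lambda>v. f v * g v)"
    and "fdeg k D (\<lambda>v. f v * g v) = fdeg k D f + fdeg k D g"
proof -
  obtain p q p' q' where r: "represents k D f p q" "represents k D g p' q'" using assms unfolding regular_def by blast
  have pq: "p \<noteq> 0 \<or> q \<noteq> 0" "p' \<noteq> 0 \<or> q' \<noteq> 0"
    using r assms(3,4) by (auto simp: represents_def vanishes_def)
  define P Q where "P = p * p' - q * q' * y_norm k D" and "Q = p * q' + q * p' + q * q' * y_trace k"
  have R: "represents k D (\<lambda>v. f v * g v) P Q" unfolding P_def Q_def by (rule represents_mult[OF r])
  have "norm_poly k D P Q - norm_poly k D p q * norm_poly k D p' q' = 0"
  proof (rule poly2_eq_0_imp)
    fix x z
    obtain v where v: "v \<in> surf k D" "v $ 1 = x" "v $ 3 = z" by (rule surf_point_over)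
    show "poly2 (norm_poly k D P Q - norm_poly k D p q * norm_poly k D p' q') x z = 0"
      unfolding v(2,3)[symmetric]
      by (simp add: norm_poly_eq[OF r(1) v(1), symmetric] norm_poly_eq[OF r(2) v(1), symmetric]
          norm_poly_eq[OF R v(1), symmetric])
  qed
  then have N: "norm_poly k D P Q = norm_poly k D p q * norm_poly k D p' q'" by simp
  have nz: "norm_poly k D p q \<noteq> 0" "norm_poly k D p' q' \<noteq> 0"
    using pq norm_poly_degree(1) by blast+
  then have "norm_poly k D P Q \<noteq> 0" unfolding N by simp
  then have PQ: "P \<noteq> 0 \<or> Q \<noteq> 0" by (auto simp: norm_poly_def)
  then show "\<not> vanishes k D (\<lambda>v. f v * g v)" using represents_vanishes[OF R] by blast
  have "2 * rep_degree P Q = 2 * rep_degree p q + 2 * rep_degree p' q'"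
    using norm_poly_degree(2)[OF PQ, of k D] norm_poly_degree(2)[OF pq(1), of k D]
      norm_poly_degree(2)[OF pq(2), of k D] degree_mult_eq[OF nz] unfolding N by simp
  then show "fdeg k D (\<lambda>v. f v * g v) = fdeg k D f + fdeg k D g"
    using fdeg_rep[OF r(1)] fdeg_rep[OF r(2)] fdeg_rep[OF R] by simp
qed

lemma fdeg_mult_le:
  assumes "regular k D f" "regular k D g"
  shows "fdeg k D (\<lambda>v. f v * g v) \<le> fdeg k D f + fdeg k D g"
proof (cases "vanishes k D f \<or> vanishes k D g")
  case True
  then have "vanishes k D (\<lambda>v. f v * g v)" by (auto simp: vanishes_def)
  then show ?thesis by (simp add: fdeg_vanishes)
qed (use fdeg_mult(2)[OF assms] in auto)

lemma fdeg_pos_not_vanishes: "fdeg k D f > 0 \<Longrightarrow> \<not> vanishes k D f"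
  using fdeg_vanishes by force

lemma fdeg_mult_pos:
  assumes "regular k D f" "regular k D g" "fdeg k D f > 0" "fdeg k D g > 0"
  shows "fdeg k D (\<lambda>v. f v * g v) = fdeg k D f + fdeg k D g"
  using assms by (intro fdeg_mult(2)) (auto dest: fdeg_pos_not_vanishes)

lemma fdeg_cmult_le:
  assumes "regular k D f" shows "fdeg k D (\<lambda>v. c * f v) \<le> fdeg k D f"
  using fdeg_mult_le[OF regular_const assms] by simp

lemma fdeg_diff_le:
  assumes "regular k D f" "regular k D g" "fdeg k D f \<le> n" "fdeg k D g \<le> n"
  shows "fdeg k D (\<lambda>v. f v - g v) \<le> n"
  using fdeg_add_le[OF assms(1) regular_mult[OF regular_const assms(2)] assms(3), of "-1"]
    fdeg_cmult_le[OF assms(2), of "-1"] assms(4) by simp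

lemma fdeg_add_eq:
  assumes "regular k D f" "regular k D g" "fdeg k D f < fdeg k D g"
  shows "fdeg k D (\<lambda>v. f v + g v) = fdeg k D g"
proof (rule antisym)
  show "fdeg k D (\<lambda>v. f v + g v) \<le> fdeg k D g"
    using assms by (intro fdeg_add_le) auto
  show "fdeg k D g \<le> fdeg k D (\<lambda>v. f v + g v)"
  proof (rule ccontr)
    assume "\<not> fdeg k D g \<le> fdeg k D (\<lambda>v. f v + g v)"
    then have "fdeg k D (\<lambda>v. (f v + g v) - f v) \<le> fdeg k D g - 1"
      using assms by (intro fdeg_diff_le) auto
    then show False using assms(3) by simp
  qed
qed

lemma fdeg_power:
  assumes "regular k D f" "fdeg k D f > 0"
  shows "fdeg k D (\<lambda>v. f v ^ n) = n * fdeg k D f"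
proof (induction n)
  case (Suc n)
  have "\<not> vanishes k D (\<lambda>v. f v ^ n)"
    using fdeg_pos_not_vanishes[OF assms(2)] by (auto simp: vanishes_def)
  then show ?case
    using fdeg_mult(2)[OF assms(1) regular_power[OF assms(1)] fdeg_pos_not_vanishes[OF assms(2)]] Suc
    by simp
qed simp

lemma fdeg_poly_le_0:
  assumes "regular k D f" "fdeg k D f = 0"
  shows "fdeg k D (\<lambda>v. poly a (f v)) = 0"
proof (induction a)
  case (pCons c a)
  have "fdeg k D (\<lambda>v. f v * poly a (f v)) \<le> 0"
    using fdeg_mult_le[OF assms(1) regular_poly[OF assms(1)], of a] pCons.IH assms(2) by simp
  then have "fdeg k D (\<lambda>v. c + f v * poly a (f v)) \<le> 0"
    using assms(1) by (intro fdeg_add_le) auto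
  then show ?case by simp
qed simp

lemma fdeg_eq_0:
  assumes "regular k D f" "fdeg k D f = 0"
  obtains a where "\<And>v. v \<in> surf k D \<Longrightarrow> f v = poly a (v $ 3)"
proof -
  obtain p q where r: "represents k D f p q" using assms unfolding regular_def by blast
  from fdeg_rep[OF r] assms(2) have d: "degree p = 0" "degree (pCons 0 q) = 0"
    by (auto simp: rep_degree_def)
  then have "q = 0" by (auto split: if_splits)
  moreover obtain a where "p = [:a:]" using d(1) by (rule degree_eq_zeroE)
  ultimately show thesis using r by (intro that[of a]) (auto simp: represents_def)
qed

lemma fdeg_le_1:
  assumes "regular k D f" "fdeg k D f \<le> 1"
  obtains a b c where
    "\<And>v. v \<in> surf k D \<Longrightarrow> f v = poly a (v $ 3) + poly b (v $ 3) * v $ 1 + poly c (v $ 3) * v $ 2"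
proof -
  obtain p q where r: "represents k D f p q" using assms unfolding regular_def by blast
  from fdeg_rep[OF r] assms(2) have d: "degree p \<le> 1" "degree (pCons 0 q) \<le> 1"
    by (auto simp: rep_degree_def)
  then have "degree q = 0" by (auto split: if_splits)
  then obtain c where c: "q = [:c:]" by (rule degree_eq_zeroE)
  obtain a p' where p: "p = pCons a p'" by (cases p) auto
  then have "degree p' = 0" using d(1) by (auto split: if_splits)
  then obtain b where b: "p' = [:b:]" by (rule degree_eq_zeroE)
  show thesis by (rule that[of a b c]) (use r in \<open>auto simp: represents_def p b c algebra_simps\<close>)
qed

lemma quadratic_relation_trivial:
  assumes "\<And>v. v \<in> surf k D \<Longrightarrow> poly e (v $ 3) + poly a (v $ 3) * v $ 1 + poly b (v $ 3) * v $ 2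
      + poly c (v $ 3) * (v $ 1)\<^sup>2 + poly d (v $ 3) * (v $ 1 * v $ 2) = 0"
  shows "e = 0" "a = 0" "b = 0" "c = 0" "d = 0"
proof -
  have "represents k D (\<lambda>v. 0) [:e, a, c:] [:b, d:]"
    using assms by (simp add: represents_def algebra_simps power2_eq_square)
  from represents_vanishes[OF this] show "e = 0" "a = 0" "b = 0" "c = 0" "d = 0"
    by (auto simp: vanishes_def)
qed

section \<open>Isomorphisms between two surfaces of the family\<close>

text \<open>
  Mutually inverse polynomial isomorphisms between two surfaces. The parameters are allowed to
  differ, because normalising an automorphism by a permutation of the target coordinates changes
  the target surface.
\<close>

definition surface_iso :: "complex ^ 3 \<Rightarrow> complex \<Rightarrow> complex ^ 3 \<Rightarrow> complex
    \<Rightarrow> (complex ^ 3 \<Rightarrow> complex ^ 3) \<Rightarrow> (complex ^ 3 \<Rightarrow> complex ^ 3) \<Rightarrow> bool" where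
  "surface_iso k D k' D' \<phi> \<psi> \<longleftrightarrow>
    (\<forall>v\<in>surf k D. \<phi> v \<in> surf k' D' \<and> \<psi> (\<phi> v) = v) \<and>
    (\<forall>v\<in>surf k' D'. \<psi> v \<in> surf k D \<and> \<phi> (\<psi> v) = v) \<and>
    (\<forall>i. regular k D (\<lambda>v. \<phi> v $ i)) \<and> (\<forall>i. regular k' D' (\<lambda>v. \<psi> v $ i))"

text \<open>The linear maps \<open>v \<mapsto> (e\<^sub>j v\<^bsub>\<pi> j\<^esub>)\<^sub>j\<close>, with signs \<open>e\<^sub>j\<close> of product 1.\<close>

definition signed_perm :: "(3 \<Rightarrow> 3) \<Rightarrow> (3 \<Rightarrow> complex) \<Rightarrow> complex ^ 3 \<Rightarrow> complex ^ 3" where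
  "signed_perm \<pi> e v = (\<chi> j. e j * v $ \<pi> j)"

definition even_signs :: "(3 \<Rightarrow> complex) \<Rightarrow> bool" where
  "even_signs e \<longleftrightarrow> (\<forall>j. e j \<in> {1, -1}) \<and> (\<Prod>j\<in>UNIV. e j) = 1"

text \<open>After composition with a word in the involutions of the target, \<open>\<phi>\<close> becomes linear.\<close>

definition reducible_to_linear ::
    "complex ^ 3 \<Rightarrow> complex \<Rightarrow> complex ^ 3 \<Rightarrow> (complex ^ 3 \<Rightarrow> complex ^ 3) \<Rightarrow> bool" where
  "reducible_to_linear k D k' \<phi> \<longleftrightarrow>
    (\<exists>w \<pi> e. bij \<pi> \<and> even_signs e \<and> (\<forall>v\<in>surf k D. word_act k' w (\<phi> v) = signed_perm \<pi> e v))"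

lemma surface_iso_vieta:
  assumes "surface_iso k D k' D' \<phi> \<psi>"
  shows "surface_iso k D k' D' (\<lambda>v. vieta k' i (\<phi> v)) (\<lambda>v. \<psi> (vieta k' i v))"
proof -
  have "regular k D (\<lambda>v. vieta k' i (\<phi> v) $ j)" for j
    using assms by (intro regular_vieta) (simp add: surface_iso_def)
  moreover have "regular k' D' (\<lambda>v. \<psi> (vieta k' i v) $ j)" for j
  proof (rule regular_compose[where f = "\<lambda>v. \<psi> v $ j"])
    show "regular k' D' (\<lambda>v. \<psi> v $ j)" using assms by (simp add: surface_iso_def)
    show "regular k' D' (\<lambda>v. vieta k' i v $ j)" for j by (intro regular_vieta) simp
  qed (rule vieta_in_surf)
  ultimately show ?thesis
    using assms by (simp add: surface_iso_def vieta_in_surf)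
qed

lemma surface_iso_perm:
  assumes "surface_iso k D k' D' \<phi> \<psi>" "bij \<pi>" "\<And>i. \<pi> (\<pi> i) = i"
  shows "surface_iso k D (permute_coords \<pi> k') D' (\<lambda>v. permute_coords \<pi> (\<phi> v)) (\<lambda>v. \<psi> (permute_coords \<pi> v))"
proof -
  have pp [simp]: "permute_coords \<pi> (permute_coords \<pi> v) = v" for v
    using assms(3) by (simp add: permute_coords_def vec_eq_iff)
  have s: "permute_coords \<pi> v \<in> surf k' D'" if "v \<in> surf (permute_coords \<pi> k') D'" for v
    using permute_coords_in_surf[OF assms(2) that] by simp
  have "regular (permute_coords \<pi> k') D' (\<lambda>v. \<psi> (permute_coords \<pi> v) $ j)" for j
  proof (rule regular_compose[where f = "\<lambda>v. \<psi> v $ j"])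
    show "regular k' D' (\<lambda>v. \<psi> v $ j)" using assms by (simp add: surface_iso_def)
    show "regular (permute_coords \<pi> k') D' (\<lambda>v. permute_coords \<pi> v $ j)" for j by (simp add: permute_coords_def)
  qed (rule s)
  then show ?thesis
    using assms(1) permute_coords_in_surf[OF assms(2)] s by (simp add: surface_iso_def) (simp add: permute_coords_def)
qed

lemma reducible_vieta:
  assumes "reducible_to_linear k D k' (\<lambda>v. vieta k' i (\<phi> v))"
  shows "reducible_to_linear k D k' \<phi>"
proof -
  obtain w \<pi> e where "bij \<pi>" "even_signs e" 
    "\<forall>v\<in>surf k D. word_act k' w (vieta k' i (\<phi> v)) = signed_perm \<pi> e v"
    using assms by (auto simp: reducible_to_linear_def)
  then show ?thesis
    unfolding reducible_to_linear_def
    by (intro exI[of _ "w @ [i]"] exI[of _ \<pi>] exI[of _ e]) (simp add: word_act_append)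
qed

lemma reducible_perm:
  assumes "reducible_to_linear k D (permute_coords \<pi> k') (\<lambda>v. permute_coords \<pi> (\<phi> v))" 
    and \<pi>: "bij \<pi>" "\<And>i. \<pi> (\<pi> i) = i"
  shows "reducible_to_linear k D k' \<phi>"
proof -
  obtain w \<rho> e where w: "bij \<rho>" "even_signs e" 
    "\<And>v. v \<in> surf k D \<Longrightarrow> word_act (permute_coords \<pi> k') w (permute_coords \<pi> (\<phi> v)) = signed_perm \<rho> e v"
    using assms(1) unfolding reducible_to_linear_def by blast
  have "word_act k' (map \<pi> w) (\<phi> v) = signed_perm (\<rho> \<circ> \<pi>) (e \<circ> \<pi>) v" if "v \<in> surf k D" for v
  proof -
    have "permute_coords \<pi> (word_act k' (map \<pi> w) (\<phi> v)) $ \<pi> j = signed_perm \<rho> e v $ \<pi> j" for j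
      using w(3)[OF that] by (simp add: permute_coords_act[OF \<pi>(1)])
    then show ?thesis
      using \<pi>(2) by (simp add: permute_coords_def signed_perm_def vec_eq_iff)
  qed
  moreover have "(\<Prod>j\<in>UNIV. e (\<pi> j)) = (\<Prod>j\<in>UNIV. e j)"
    by (rule prod.reindex_bij_betw[OF \<pi>(1)])
  ultimately show ?thesis
    using w(1,2) \<pi>(1) unfolding reducible_to_linear_def
    by (intro exI[of _ "map \<pi> w"] exI[of _ "\<rho> \<circ> \<pi>"] exI[of _ "e \<circ> \<pi>"])
      (auto simp: even_signs_def bij_comp)
qed

text \<open>
  Markov's descent. If \<open>f\<close> has the largest degree and \<open>f'\<close> is the other root, then \<open>f f'\<close> has degree at
  most twice the maximum \<open>m\<close> of the degrees of \<open>g\<close> and \<open>h\<close>. If \<open>f'\<close> had degree at least that of \<open>f\<close>,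
  then \<open>f\<close>, \<open>f'\<close> and one of \<open>g, h\<close> would have degree \<open>m\<close>; so \<open>g h = a - f - f'\<close> would have degree at
  most \<open>m\<close>, although both factors have positive degree and one of them has degree \<open>m\<close>.
\<close>

lemma markov_vieta_degree:
  assumes r: "regular k D f" "regular k D g" "regular k D h"
    and eq: "\<And>v. v \<in> surf k D \<Longrightarrow>
      (f v)\<^sup>2 + (g v)\<^sup>2 + (h v)\<^sup>2 + f v * g v * h v = a * f v + b * g v + c * h v + d"
    and pos: "fdeg k D f > 0" "fdeg k D g > 0" "fdeg k D h > 0"
    and le: "fdeg k D g \<le> fdeg k D f" "fdeg k D h \<le> fdeg k D f"
  shows "fdeg k D (\<lambda>v. a - f v - g v * h v) < fdeg k D f"
proof (rule ccontr)
  define f' where "f' = (\<lambda>v. a - f v - g v * h v)"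
  define m where "m = max (fdeg k D g) (fdeg k D h)"
  assume "\<not> fdeg k D (\<lambda>v. a - f v - g v * h v) < fdeg k D f"
  then have ge: "fdeg k D f' \<ge> fdeg k D f" by (simp add: f'_def)
  have rf': "regular k D f'" unfolding f'_def using r by auto
  have "fdeg k D (\<lambda>v. f v * f' v) = fdeg k D (\<lambda>v. (g v)\<^sup>2 + (h v)\<^sup>2 - (b * g v + (c * h v + d)))"
    by (rule fdeg_cong) (use eq in \<open>simp add: f'_def algebra_simps power2_eq_square\<close>)
  also have "\<dots> \<le> 2 * m"
  proof -
    have "fdeg k D (\<lambda>v. (g v)\<^sup>2) \<le> 2 * m" "fdeg k D (\<lambda>v. (h v)\<^sup>2) \<le> 2 * m"
      using fdeg_power[OF r(2) pos(2), of 2] fdeg_power[OF r(3) pos(3), of 2] by (auto simp: m_def)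
    moreover have "fdeg k D (\<lambda>v. b * g v) \<le> 2 * m" "fdeg k D (\<lambda>v. c * h v) \<le> 2 * m"
      using fdeg_cmult_le[OF r(2), of b] fdeg_cmult_le[OF r(3), of c] by (auto simp: m_def)
    ultimately show ?thesis
      using r by (intro fdeg_diff_le fdeg_add_le) auto
  qed
  finally have "fdeg k D f + fdeg k D f' \<le> 2 * m"
    using fdeg_mult_pos[OF r(1) rf' pos(1)] ge pos(1) by simp
  then have m: "m = fdeg k D f" "fdeg k D f' = fdeg k D f" using ge le by (auto simp: m_def)
  have "fdeg k D (\<lambda>v. g v * h v) = fdeg k D (\<lambda>v. a - (f v + f' v))"
    by (rule fdeg_cong) (simp add: f'_def)
  also have "\<dots> \<le> fdeg k D f"
    using r rf' m by (intro fdeg_diff_le fdeg_add_le) auto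
  finally have "fdeg k D g + fdeg k D h \<le> fdeg k D f"
    using fdeg_mult_pos[OF r(2,3) pos(2,3)] by simp
  then show False using m(1) pos by (auto simp: m_def)
qed

text \<open>If \<open>h\<close> is a function of \<open>z\<close> and \<open>f\<close> had larger degree than \<open>g\<close>, the term \<open>f\<^sup>2\<close> would be alone in its degree.\<close>

lemma markov_fibration_degree:
  assumes r: "regular k D f" "regular k D g" "regular k D h"
    and eq: "\<And>v. v \<in> surf k D \<Longrightarrow>
      (f v)\<^sup>2 + (g v)\<^sup>2 + (h v)\<^sup>2 + f v * g v * h v = a * f v + b * g v + c * h v + d"
    and h: "fdeg k D h = 0"
  shows "fdeg k D f \<le> fdeg k D g"
proof (rule ccontr)
  assume "\<not> ?thesis"
  then have lt: "fdeg k D g < fdeg k D f" by simp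
  define R where "R = (\<lambda>v. (a * f v + (b * g v + (c * h v + d))) - (g v * g v + (h v * h v + f v * (g v * h v))))"
  have "fdeg k D R \<le> fdeg k D f + fdeg k D g"
  proof -
    have "fdeg k D (\<lambda>v. g v * h v) \<le> fdeg k D g" "fdeg k D (\<lambda>v. h v * h v) \<le> 0"
      "fdeg k D (\<lambda>v. g v * g v) \<le> fdeg k D g + fdeg k D g"
      using fdeg_mult_le[OF r(2,3)] fdeg_mult_le[OF r(3,3)] fdeg_mult_le[OF r(2,2)] h by auto
    moreover have "fdeg k D (\<lambda>v. f v * (g v * h v)) \<le> fdeg k D f + fdeg k D (\<lambda>v. g v * h v)"
      using r by (intro fdeg_mult_le) auto
    ultimately show ?thesis unfolding R_def
      using r lt h fdeg_cmult_le[OF r(1), of a] fdeg_cmult_le[OF r(2), of b] fdeg_cmult_le[OF r(3), of c]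
      by (intro fdeg_diff_le fdeg_add_le) auto
  qed
  moreover have "fdeg k D R = fdeg k D (\<lambda>v. f v ^ 2)"
    by (rule fdeg_cong) (use eq in \<open>simp add: R_def algebra_simps power2_eq_square\<close>)
  moreover have "\<dots> = 2 * fdeg k D f" using lt by (intro fdeg_power r) auto
  ultimately show False using lt by linarith
qed

text \<open>
  Substitution of \<open>f\<close> and \<open>g\<close> for \<open>x\<close> and \<open>z\<close>, where \<open>g\<close> is a function of \<open>z\<close> that is transcendental over
  the constants: the powers of \<open>f\<close> have different degrees, so no cancellation occurs.
\<close>

lemma fdeg_poly2:
  assumes f: "regular k D f" "fdeg k D f > 0" and g: "regular k D g" "fdeg k D g = 0"
    and nv: "\<And>c. c \<noteq> 0 \<Longrightarrow> \<not> vanishes k D (\<lambda>v. poly c (g v))"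
  shows "p \<noteq> 0 \<Longrightarrow> \<not> vanishes k D (\<lambda>v. poly2 p (f v) (g v)) \<and>
    fdeg k D (\<lambda>v. poly2 p (f v) (g v)) = degree p * fdeg k D f"
proof (induction p)
  case (pCons c p)
  show ?case
  proof (cases "p = 0")
    case True
    then show ?thesis using pCons nv fdeg_poly_le_0[OF g] by simp
  next
    case False
    then have IH: "\<not> vanishes k D (\<lambda>v. poly2 p (f v) (g v))"
      "fdeg k D (\<lambda>v. poly2 p (f v) (g v)) = degree p * fdeg k D f"
      using pCons.IH by auto
    have "fdeg k D (\<lambda>v. f v * poly2 p (f v) (g v)) = fdeg k D f + degree p * fdeg k D f"
      using fdeg_mult(2)[OF f(1) regular_poly2[OF f(1) g(1)] fdeg_pos_not_vanishes[OF f(2)] IH(1)] IH(2) by simp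
    moreover from this have "fdeg k D (\<lambda>v. poly c (g v) + f v * poly2 p (f v) (g v))
        = fdeg k D (\<lambda>v. f v * poly2 p (f v) (g v))"
      using f g fdeg_poly_le_0[OF g] by (intro fdeg_add_eq) auto
    ultimately have d: "fdeg k D (\<lambda>v. poly2 (pCons c p) (f v) (g v)) = degree (pCons c p) * fdeg k D f"
      using False by simp
    moreover have "degree (pCons c p) * fdeg k D f > 0" using False f(2) by simp
    ultimately have "\<not> vanishes k D (\<lambda>v. poly2 (pCons c p) (f v) (g v))"
      using fdeg_pos_not_vanishes by metis
    with d show ?thesis by blast
  qed
qed simp

lemma fdeg_poly:
  assumes f: "regular k D f" "fdeg k D f > 0"
  shows "fdeg k D (\<lambda>v. poly a (f v)) = degree a * fdeg k D f"
proof (cases "a = 0")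
  case False
  define p where "p = map_poly (\<lambda>c. [:c:]) a"
  have deg: "degree p = degree a" unfolding p_def by (rule degree_map_poly) auto
  have "p \<noteq> 0" using False by (simp add: p_def map_poly_eq_0_iff)
  have "fdeg k D (\<lambda>v. poly2 p (f v) (v $ 3)) = degree p * fdeg k D f"
  proof -
    have "\<not> vanishes k D (\<lambda>v. poly c (v $ 3))" if "c \<noteq> 0" for c
    proof
      assume "vanishes k D (\<lambda>v. poly c (v $ 3))"
      then have "poly c z = 0" for z
        by (metis surf_point_over vanishes_def)
      then show False using that poly_all_0_iff_0 by blast
    qed
    then show ?thesis
      using fdeg_poly2[OF f, of "\<lambda>v. v $ 3" p] \<open>p \<noteq> 0\<close> by simp
  qed
  moreover have "poly2 p x z = poly a x" for x z
    unfolding p_def by (induction a) (auto simp: map_poly_pCons)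
  ultimately show ?thesis by (simp add: deg)
qed simp

lemma fdeg_poly2_le:
  assumes f: "regular k D f" "fdeg k D f \<le> n" and g: "regular k D g" "fdeg k D g = 0"
  shows "fdeg k D (\<lambda>v. poly2 p (f v) (g v)) \<le> degree p * n"
proof (induction p)
  case (pCons c p)
  show ?case
  proof (cases "p = 0")
    case True
    then show ?thesis using fdeg_poly_le_0[OF g] by simp
  next
    case False
    have "fdeg k D (\<lambda>v. f v * poly2 p (f v) (g v)) \<le> fdeg k D f + fdeg k D (\<lambda>v. poly2 p (f v) (g v))"
      using f g by (intro fdeg_mult_le) auto
    then have "fdeg k D (\<lambda>v. f v * poly2 p (f v) (g v)) \<le> degree (pCons c p) * n"
      using f(2) pCons.IH False by simp
    then have "fdeg k D (\<lambda>v. poly c (g v) + f v * poly2 p (f v) (g v)) \<le> degree (pCons c p) * n"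
      using f g fdeg_poly_le_0[OF g] by (intro fdeg_add_le) auto
    then show ?thesis by simp
  qed
qed simp

lemma fdeg_compose_le:
  assumes h: "represents k' D' h p q" 
    and \<phi>: "\<And>i. regular k D (\<lambda>v. \<phi> v $ i)" "\<And>v. v \<in> surf k D \<Longrightarrow> \<phi> v \<in> surf k' D'"
    and d: "fdeg k D (\<lambda>v. \<phi> v $ 1) \<le> n" "fdeg k D (\<lambda>v. \<phi> v $ 2) \<le> n" "fdeg k D (\<lambda>v. \<phi> v $ 3) = 0"
  shows "fdeg k D (\<lambda>v. h (\<phi> v)) \<le> rep_degree p q * n"
proof -
  have "fdeg k D (\<lambda>v. h (\<phi> v))
      = fdeg k D (\<lambda>v. poly2 p (\<phi> v $ 1) (\<phi> v $ 3) + poly2 q (\<phi> v $ 1) (\<phi> v $ 3) * \<phi> v $ 2)"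
    by (rule fdeg_cong) (use h \<phi>(2) in \<open>auto simp: represents_def\<close>)
  also have "\<dots> \<le> rep_degree p q * n"
  proof (rule fdeg_add_le)
    have "degree p * n \<le> rep_degree p q * n" by (simp add: rep_degree_def)
    then show "fdeg k D (\<lambda>v. poly2 p (\<phi> v $ 1) (\<phi> v $ 3)) \<le> rep_degree p q * n"
      using fdeg_poly2_le[OF \<phi>(1) d(1) \<phi>(1) d(3), of p] by linarith
    show "fdeg k D (\<lambda>v. poly2 q (\<phi> v $ 1) (\<phi> v $ 3) * \<phi> v $ 2) \<le> rep_degree p q * n"
    proof (cases "q = 0")
      case False
      have "fdeg k D (\<lambda>v. poly2 q (\<phi> v $ 1) (\<phi> v $ 3) * \<phi> v $ 2) \<le> degree q * n + n"
        using fdeg_mult_le[OF regular_poly2[OF \<phi>(1) \<phi>(1)] \<phi>(1), of q 1 3 2]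
          fdeg_poly2_le[OF \<phi>(1) d(1) \<phi>(1) d(3), of q] d(2) by linarith
      also have "\<dots> = degree (pCons 0 q) * n" using False by simp
      also have "\<dots> \<le> rep_degree p q * n" by (simp add: rep_degree_def)
      finally show ?thesis .
    qed simp
  qed (use \<phi> in auto)
  finally show ?thesis .
qed

lemma surface_iso_markov:
  assumes "surface_iso k D k' D' \<phi> \<psi>" "v \<in> surf k D"
  shows "(\<phi> v $ 1)\<^sup>2 + (\<phi> v $ 2)\<^sup>2 + (\<phi> v $ 3)\<^sup>2 + \<phi> v $ 1 * \<phi> v $ 2 * \<phi> v $ 3
     = k' $ 1 * \<phi> v $ 1 + k' $ 2 * \<phi> v $ 2 + k' $ 3 * \<phi> v $ 3 + D'"
  using assms by (simp add: surface_iso_def surf_iff[symmetric])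

section \<open>Isomorphisms that preserve the conic fibration\<close>

text \<open>
  If the third component is a polynomial \<open>\<tau>\<close> in \<open>z\<close>, then \<open>\<tau>\<close> applied to the third component of the inverse is
  \<open>z\<close>. Hence that component has degree 0 as well, so it is a polynomial in \<open>z\<close>, and \<open>\<tau>\<close> has degree 1.
\<close>

lemma fibration_affine:
  assumes P: "surface_iso k D k' D' \<phi> \<psi>" and d: "fdeg k D (\<lambda>v. \<phi> v $ 3) = 0"
  obtains \<alpha> \<beta> where "\<alpha> \<noteq> 0" "\<And>v. v \<in> surf k D \<Longrightarrow> \<phi> v $ 3 = \<alpha> * v $ 3 + \<beta>"
proof -
  have rp: "regular k D (\<lambda>v. \<phi> v $ i)" "regular k' D' (\<lambda>v. \<psi> v $ i)" for i using P by (auto simp: surface_iso_def)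
  obtain \<tau> where \<tau>: "\<And>v. v \<in> surf k D \<Longrightarrow> \<phi> v $ 3 = poly \<tau> (v $ 3)"
    using fdeg_eq_0[OF rp(1) d] by blast
  have inv: "poly \<tau> (\<psi> v $ 3) = v $ 3" if "v \<in> surf k' D'" for v
    using P that \<tau>[of "\<psi> v"] by (simp add: surface_iso_def)
  have "degree \<tau> \<noteq> 0"
  proof
    assume "degree \<tau> = 0"
    then obtain c where "\<tau> = [:c:]" by (rule degree_eq_zeroE)
    then have "v $ 3 = c" if "v \<in> surf k' D'" for v using inv[OF that] by simp
    moreover obtain v where "v \<in> surf k' D'" "v $ 3 = c + 1"
      by (rule surf_point_over[where x = 0 and z = "c + 1"])
    ultimately show False by fastforce
  qed
  have "fdeg k' D' (\<lambda>v. \<psi> v $ 3) = 0"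
  proof (rule ccontr)
    assume "\<not> ?thesis"
    then have "fdeg k' D' (\<lambda>v. poly \<tau> (\<psi> v $ 3)) > 0"
      using fdeg_poly[OF rp(2), of 3 \<tau>] \<open>degree \<tau> \<noteq> 0\<close> by simp
    moreover have "fdeg k' D' (\<lambda>v. poly \<tau> (\<psi> v $ 3)) = fdeg k' D' (\<lambda>v. v $ 3)"
      by (rule fdeg_cong) (rule inv)
    ultimately show False by simp
  qed
  then obtain \<sigma> where \<sigma>: "\<And>v. v \<in> surf k' D' \<Longrightarrow> \<psi> v $ 3 = poly \<sigma> (v $ 3)"
    using fdeg_eq_0[OF rp(2)] by blast
  have "poly (pcompose \<tau> \<sigma>) z = poly [:0, 1:] z" for z
  proof -
    obtain v where "v \<in> surf k' D'" "v $ 3 = z" by (rule surf_point_over[where x = 0 and z = z])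
    then show ?thesis using inv \<sigma> by (fastforce simp: poly_pcompose)
  qed
  then have "pcompose \<tau> \<sigma> = [:0, 1:]" by (simp add: poly_eq_poly_eq_iff[symmetric] fun_eq_iff)
  then have "degree \<tau> * degree \<sigma> = 1" using degree_pcompose[of \<tau> \<sigma>] by simp
  then have "degree \<tau> = 1" by simp
  obtain \<beta> \<tau>' where t: "\<tau> = pCons \<beta> \<tau>'" by (cases \<tau>) auto
  then have "\<tau>' \<noteq> 0" "degree \<tau>' = 0" using \<open>degree \<tau> = 1\<close> by (auto split: if_splits)
  then obtain \<alpha> where "\<tau> = [:\<beta>, \<alpha>:]" "\<alpha> \<noteq> 0" using t by (auto elim: degree_eq_zeroE)
  then show thesis using \<tau> by (intro that[of \<alpha> \<beta>]) (auto simp: algebra_simps)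
qed

text \<open>
  The first two components have the same degree \<open>g\<close>. Let \<open>n\<close> be the degree of a component \<open>\<psi>\<^sub>i\<close> of the
  inverse, for \<open>i = 1, 2\<close>. Composing the norm of \<open>\<psi>\<^sub>i\<close> with \<open>\<phi>\<close> gives a function of degree exactly
  \<open>2 n g\<close>, which is the product of \<open>v\<^sub>i\<close>, of degree 1, and of a function of degree at most \<open>n g\<close>. Hence
  \<open>n g \<le> 1\<close>.
\<close>

lemma fibration_degree_1:
  assumes P: "surface_iso k D k' D' \<phi> \<psi>" and d: "fdeg k D (\<lambda>v. \<phi> v $ 3) = 0" and i: "i \<in> {1, 2}"
  shows "fdeg k D (\<lambda>v. \<phi> v $ i) = 1" "fdeg k' D' (\<lambda>v. \<psi> v $ i) = 1"
proof -
  have rp: "regular k D (\<lambda>v. \<phi> v $ i)" "regular k' D' (\<lambda>v. \<psi> v $ i)" for i using P by (auto simp: surface_iso_def)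
  have maps: "\<phi> v \<in> surf k' D'" "\<psi> (\<phi> v) = v" if "v \<in> surf k D" for v using P that by (auto simp: surface_iso_def)
  obtain \<alpha> \<beta> where ab: "\<alpha> \<noteq> 0" "\<And>v. v \<in> surf k D \<Longrightarrow> \<phi> v $ 3 = \<alpha> * v $ 3 + \<beta>"
    using fibration_affine[OF P d] by blast
  have nv: "\<not> vanishes k D (\<lambda>v. poly c (\<phi> v $ 3))" if "c \<noteq> 0" for c
  proof
    assume V: "vanishes k D (\<lambda>v. poly c (\<phi> v $ 3))"
    have "poly c z = 0" for z
    proof -
      obtain v where "v \<in> surf k D" "v $ 3 = (z - \<beta>) / \<alpha>"
        by (rule surf_point_over[where x = 0 and z = "(z - \<beta>) / \<alpha>"])
      then have "v \<in> surf k D" "\<phi> v $ 3 = z" using ab by auto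
      then show ?thesis using V by (auto simp: vanishes_def)
    qed
    then show False using that poly_all_0_iff_0 by blast
  qed
  define g where "g = fdeg k D (\<lambda>v. \<phi> v $ 1)"
  have g2: "fdeg k D (\<lambda>v. \<phi> v $ 2) = g"
  proof (rule antisym)
    show "fdeg k D (\<lambda>v. \<phi> v $ 2) \<le> g" unfolding g_def
      by (rule markov_fibration_degree[OF rp(1) rp(1) rp(1) _ d,
            where a = "k' $ 2" and b = "k' $ 1" and c = "k' $ 3" and d = D'])
        (use surface_iso_markov[OF P] in \<open>simp add: algebra_simps\<close>)
    show "g \<le> fdeg k D (\<lambda>v. \<phi> v $ 2)" unfolding g_def
      by (rule markov_fibration_degree[OF rp(1) rp(1) rp(1) _ d,
            where a = "k' $ 1" and b = "k' $ 2" and c = "k' $ 3" and d = D'])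
        (use surface_iso_markov[OF P] in simp)
  qed
  have "g = 1 \<and> fdeg k' D' (\<lambda>v. \<psi> v $ i) = 1"
  proof -
    obtain p q where pq: "represents k' D' (\<lambda>v. \<psi> v $ i) p q" using rp(2) unfolding regular_def by blast
    define n where "n = rep_degree p q"
    have "fdeg k D (\<lambda>v. v $ i) = 1" using i by auto
    then have "fdeg k D (\<lambda>v. \<psi> (\<phi> v) $ i) = 1"
      using fdeg_cong[of k D "\<lambda>v. \<psi> (\<phi> v) $ i" "\<lambda>v. v $ i"] maps(2) by simp
    moreover have "fdeg k D (\<lambda>v. \<psi> (\<phi> v) $ i) \<le> n * g"
      unfolding n_def by (rule fdeg_compose_le[OF pq rp(1) maps(1)]) (use d g2 in \<open>auto simp: g_def\<close>)
    ultimately have ng: "n * g \<ge> 1" by simp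
    then have gpos: "g > 0" and "n > 0" by auto
    then have pq0: "p \<noteq> 0 \<or> q \<noteq> 0" by (auto simp: n_def rep_degree_def)
    define N where "N = norm_poly k' D' p q"
    have N: "N \<noteq> 0" "degree N = 2 * n"
      using norm_poly_degree[OF pq0, of k' D'] by (auto simp: N_def n_def)
    have "2 * n * g = fdeg k D (\<lambda>v. poly2 N (\<phi> v $ 1) (\<phi> v $ 3))"
      using fdeg_poly2[OF rp(1) _ rp(1) d nv N(1), of 1] gpos N(2) by (simp add: g_def)
    also have "\<dots> = fdeg k D (\<lambda>v. v $ i * \<psi> (vieta k' 2 (\<phi> v)) $ i)"
    proof (rule fdeg_cong)
      fix v assume "v \<in> surf k D"
      then show "poly2 N (\<phi> v $ 1) (\<phi> v $ 3) = v $ i * \<psi> (vieta k' 2 (\<phi> v)) $ i"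
        using norm_poly_eq[OF pq, of "\<phi> v"] maps by (simp add: N_def)
    qed
    also have "\<dots> \<le> fdeg k D (\<lambda>v. v $ i) + fdeg k D (\<lambda>v. \<psi> (vieta k' 2 (\<phi> v)) $ i)"
    proof (rule fdeg_mult_le)
      show "regular k D (\<lambda>v. \<psi> (vieta k' 2 (\<phi> v)) $ i)"
        by (rule regular_compose[OF rp(2), of k D "\<lambda>v. vieta k' 2 (\<phi> v)"])
          (use rp(1) maps in \<open>auto intro: regular_vieta vieta_in_surf\<close>)
    qed simp
    also have "fdeg k D (\<lambda>v. v $ i) = 1" using i by auto
    also have "fdeg k D (\<lambda>v. \<psi> (vieta k' 2 (\<phi> v)) $ i) \<le> n * g"
      unfolding n_def
    proof (rule fdeg_compose_le[OF pq, of k D "\<lambda>v. vieta k' 2 (\<phi> v)"])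
      have "fdeg k D (\<lambda>v. \<phi> v $ 1 * \<phi> v $ 3) \<le> g"
        using fdeg_mult_le[OF rp(1) rp(1), of 1 3] d by (simp add: g_def)
      then show "fdeg k D (\<lambda>v. vieta k' 2 (\<phi> v) $ 2) \<le> g"
        using rp(1) g2 by (simp add: vieta_simps, intro fdeg_diff_le) auto
      show "regular k D (\<lambda>v. vieta k' 2 (\<phi> v) $ j)" for j by (rule regular_vieta) (rule rp(1))
      show "vieta k' 2 (\<phi> v) \<in> surf k' D'" if "v \<in> surf k D" for v
        by (rule vieta_in_surf) (rule maps(1)[OF that])
    qed (use d in \<open>simp_all add: vieta_simps g_def\<close>)
    finally have "n * g \<le> 1" by (simp add: mult.commute)
    with ng have "n * g = 1" by (rule antisym[rotated])
    then show ?thesis using fdeg_rep[OF pq] by (simp add: n_def)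
  qed
  then show "fdeg k D (\<lambda>v. \<phi> v $ i) = 1" "fdeg k' D' (\<lambda>v. \<psi> v $ i) = 1"
    using i g2 by (auto simp: g_def)
qed

lemma linear_unique:
  assumes "\<And>v. v \<in> surf k D \<Longrightarrow> poly e (v $ 3) + poly a (v $ 3) * v $ 1 + poly b (v $ 3) * v $ 2 = 0"
  shows "e = 0" "a = 0" "b = 0"
  using quadratic_relation_trivial[of k D e a b 0 0] assms by auto

text \<open>Expressing \<open>x\<close> and \<open>y\<close> through the components shows that the coefficient matrix is invertible over \<open>\<complex>[z]\<close>.\<close>

lemma fibration_determinant:
  assumes P: "surface_iso k D k' D' \<phi> \<psi>" and d: "fdeg k D (\<lambda>v. \<phi> v $ 3) = 0"
    and rep1: "\<And>v. v \<in> surf k D \<Longrightarrow> \<phi> v $ 1 = poly a1 (v $ 3) + poly b1 (v $ 3) * v $ 1 + poly c1 (v $ 3) * v $ 2"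
    and rep2: "\<And>v. v \<in> surf k D \<Longrightarrow> \<phi> v $ 2 = poly a2 (v $ 3) + poly b2 (v $ 3) * v $ 1 + poly c2 (v $ 3) * v $ 2"
  obtains \<kappa> where "\<kappa> \<noteq> 0" "b1 * c2 - b2 * c1 = [:\<kappa>:]"
proof -
  have rp: "regular k D (\<lambda>v. \<phi> v $ i)" "regular k' D' (\<lambda>v. \<psi> v $ i)" for i using P by (auto simp: surface_iso_def)
  have maps: "\<phi> v \<in> surf k' D'" "\<psi> (\<phi> v) = v" if "v \<in> surf k D" for v using P that by (auto simp: surface_iso_def)
  obtain \<alpha> \<beta> where ab: "\<alpha> \<noteq> 0" "\<And>v. v \<in> surf k D \<Longrightarrow> \<phi> v $ 3 = \<alpha> * v $ 3 + \<beta>"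
    using fibration_affine[OF P d] by blast
  have ex: "\<exists>E F G. \<forall>v\<in>surf k D. v $ i = poly E (v $ 3) + poly F (v $ 3) * \<phi> v $ 1 + poly G (v $ 3) * \<phi> v $ 2"
    if i: "i \<in> {1, 2}" for i
  proof -
    obtain e f g where efg: "\<And>v. v \<in> surf k' D' \<Longrightarrow>
        \<psi> v $ i = poly e (v $ 3) + poly f (v $ 3) * v $ 1 + poly g (v $ 3) * v $ 2"
      using fdeg_le_1[OF rp(2), of i] fibration_degree_1(2)[OF P d i] by auto
    have "v $ i = poly (pcompose e [:\<beta>, \<alpha>:]) (v $ 3) + poly (pcompose f [:\<beta>, \<alpha>:]) (v $ 3) * \<phi> v $ 1
        + poly (pcompose g [:\<beta>, \<alpha>:]) (v $ 3) * \<phi> v $ 2" if "v \<in> surf k D" for v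
      using efg[OF maps(1)[OF that]] maps(2)[OF that] ab(2)[OF that]
      by (simp add: poly_pcompose algebra_simps)
    then show ?thesis by blast
  qed
  obtain E1 F1 G1 where 1: "\<And>v. v \<in> surf k D \<Longrightarrow>
      v $ 1 = poly E1 (v $ 3) + poly F1 (v $ 3) * \<phi> v $ 1 + poly G1 (v $ 3) * \<phi> v $ 2" using ex[of 1] by blast
  obtain E2 F2 G2 where 2: "\<And>v. v \<in> surf k D \<Longrightarrow>
      v $ 2 = poly E2 (v $ 3) + poly F2 (v $ 3) * \<phi> v $ 1 + poly G2 (v $ 3) * \<phi> v $ 2" using ex[of 2] by blast
  have "poly (E1 + F1 * a1 + G1 * a2) (v $ 3) + poly (F1 * b1 + G1 * b2 - 1) (v $ 3) * v $ 1
      + poly (F1 * c1 + G1 * c2) (v $ 3) * v $ 2 = 0" if "v \<in> surf k D" for v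
    using 1[OF that] unfolding rep1[OF that] rep2[OF that] by (simp add: algebra_simps)
  from linear_unique(2,3)[OF this] have m1: "F1 * b1 + G1 * b2 = 1" "F1 * c1 + G1 * c2 = 0" by auto
  have "poly (E2 + F2 * a1 + G2 * a2) (v $ 3) + poly (F2 * b1 + G2 * b2) (v $ 3) * v $ 1
      + poly (F2 * c1 + G2 * c2 - 1) (v $ 3) * v $ 2 = 0" if "v \<in> surf k D" for v
    using 2[OF that] unfolding rep1[OF that] rep2[OF that] by (simp add: algebra_simps)
  from linear_unique(2,3)[OF this] have m2: "F2 * b1 + G2 * b2 = 0" "F2 * c1 + G2 * c2 = 1" by auto
  have "(F1 * G2 - G1 * F2) * (b1 * c2 - b2 * c1)
      = (F1 * b1 + G1 * b2) * (F2 * c1 + G2 * c2) - (F1 * c1 + G1 * c2) * (F2 * b1 + G2 * b2)"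
    by (simp add: algebra_simps)
  then have "b1 * c2 - b2 * c1 dvd 1" unfolding m1 m2 by (metis diff_zero dvd_triv_right mult_1 mult_zero_left)
  then obtain \<kappa> where "b1 * c2 - b2 * c1 = [:\<kappa>:]" "\<kappa> dvd 1" unfolding is_unit_poly_iff by blast
  moreover from this have "\<kappa> \<noteq> 0" by auto
  ultimately show thesis using that by blast
qed

text \<open>
  The equation of the target surface, compared coefficientwise with \<open>\<mu>\<close> times that of the source; here
  \<open>\<mu>\<close> is the coefficient of \<open>y\<^sup>2\<close>, and the equations belong to \<open>x\<^sup>2\<close>, \<open>x y\<close>, \<open>x\<close>, \<open>y\<close> and 1.
\<close>

lemma fibration_equations:
  assumes P: "surface_iso k D k' D' \<phi> \<psi>"
    and rep1: "\<And>v. v \<in> surf k D \<Longrightarrow> \<phi> v $ 1 = poly a1 (v $ 3) + poly b1 (v $ 3) * v $ 1 + poly c1 (v $ 3) * v $ 2"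
    and rep2: "\<And>v. v \<in> surf k D \<Longrightarrow> \<phi> v $ 2 = poly a2 (v $ 3) + poly b2 (v $ 3) * v $ 1 + poly c2 (v $ 3) * v $ 2"
    and rep3: "\<And>v. v \<in> surf k D \<Longrightarrow> \<phi> v $ 3 = poly T (v $ 3)"
    and \<mu>: "\<mu> = c1\<^sup>2 + c2\<^sup>2 + T * c1 * c2"
  shows "b1\<^sup>2 + b2\<^sup>2 + T * b1 * b2 = \<mu>"
    "2 * b1 * c1 + 2 * b2 * c2 + T * (b1 * c2 + b2 * c1) = [:0, 1:] * \<mu>"
    "2 * a1 * b1 + 2 * a2 * b2 + T * (a1 * b2 + a2 * b1) - [:k' $ 1:] * b1 - [:k' $ 2:] * b2 + \<mu> * [:k $ 1:] = 0"
    "2 * a1 * c1 + 2 * a2 * c2 + T * (a1 * c2 + a2 * c1) - [:k' $ 1:] * c1 - [:k' $ 2:] * c2 + \<mu> * [:k $ 2:] = 0"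
    "a1\<^sup>2 + a2\<^sup>2 + T\<^sup>2 + T * a1 * a2 - [:k' $ 1:] * a1 - [:k' $ 2:] * a2 - [:k' $ 3:] * T - [:D':]
      + \<mu> * [:D, k $ 3, -1:] = 0"
proof -
  let ?e = "a1\<^sup>2 + a2\<^sup>2 + T\<^sup>2 + T * a1 * a2 - [:k' $ 1:] * a1 - [:k' $ 2:] * a2 - [:k' $ 3:] * T - [:D':]
      + \<mu> * [:D, k $ 3, -1:]"
  let ?a = "2 * a1 * b1 + 2 * a2 * b2 + T * (a1 * b2 + a2 * b1) - [:k' $ 1:] * b1 - [:k' $ 2:] * b2 + \<mu> * [:k $ 1:]"
  let ?b = "2 * a1 * c1 + 2 * a2 * c2 + T * (a1 * c2 + a2 * c1) - [:k' $ 1:] * c1 - [:k' $ 2:] * c2 + \<mu> * [:k $ 2:]"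
  let ?c = "b1\<^sup>2 + b2\<^sup>2 + T * b1 * b2 - \<mu>"
  let ?d = "2 * b1 * c1 + 2 * b2 * c2 + T * (b1 * c2 + b2 * c1) - [:0, 1:] * \<mu>"
  have 0: "poly ?e (v $ 3) + poly ?a (v $ 3) * v $ 1 + poly ?b (v $ 3) * v $ 2
      + poly ?c (v $ 3) * (v $ 1)\<^sup>2 + poly ?d (v $ 3) * (v $ 1 * v $ 2) = 0" if v: "v \<in> surf k D" for v
  proof -
    define x y z where "x = v $ 1" and "y = v $ 2" and "z = v $ 3"
    have S: "x\<^sup>2 + y\<^sup>2 + z\<^sup>2 + x * y * z = k $ 1 * x + k $ 2 * y + k $ 3 * z + D"
      using v by (simp add: surf_iff x_def y_def z_def)
    define A1 B1 C1 A2 B2 C2 t where "A1 = poly a1 z" "B1 = poly b1 z" "C1 = poly c1 z"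
      "A2 = poly a2 z" "B2 = poly b2 z" "C2 = poly c2 z" "t = poly T z"
    note defs = this
    define X Y where "X = A1 + B1 * x + C1 * y" and "Y = A2 + B2 * x + C2 * y"
    have "X\<^sup>2 + Y\<^sup>2 + t\<^sup>2 + X * Y * t = k' $ 1 * X + k' $ 2 * Y + k' $ 3 * t + D'"
      using surface_iso_markov[OF P v] rep1[OF v] rep2[OF v] rep3[OF v]
      by (simp add: X_def Y_def defs x_def y_def z_def)
    moreover have pm: "poly \<mu> z = C1\<^sup>2 + C2\<^sup>2 + t * C1 * C2" by (simp add: \<mu> defs)
    define m where "m = C1\<^sup>2 + C2\<^sup>2 + t * C1 * C2"
    have "poly ?e z + poly ?a z * x + poly ?b z * y + poly ?c z * x\<^sup>2 + poly ?d z * (x * y)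
      = (X\<^sup>2 + Y\<^sup>2 + t\<^sup>2 + X * Y * t - (k' $ 1 * X + k' $ 2 * Y + k' $ 3 * t + D'))
        - m * (x\<^sup>2 + y\<^sup>2 + z\<^sup>2 + x * y * z - (k $ 1 * x + k $ 2 * y + k $ 3 * z + D))"
      by (simp add: pm defs[symmetric] X_def Y_def m_def power2_eq_square algebra_simps)
    ultimately show ?thesis using S by (simp add: x_def y_def z_def)
  qed
  show "b1\<^sup>2 + b2\<^sup>2 + T * b1 * b2 = \<mu>"
    using quadratic_relation_trivial(4)[of k D ?e ?a ?b ?c ?d, OF 0] by (simp only: right_minus_eq)
  show "2 * b1 * c1 + 2 * b2 * c2 + T * (b1 * c2 + b2 * c1) = [:0, 1:] * \<mu>"
    using quadratic_relation_trivial(5)[of k D ?e ?a ?b ?c ?d, OF 0] by (simp only: right_minus_eq)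
  show "?a = 0" by (rule quadratic_relation_trivial(2)[of k D ?e ?a ?b ?c ?d, OF 0])
  show "?b = 0" by (rule quadratic_relation_trivial(3)[of k D ?e ?a ?b ?c ?d, OF 0])
  show "?e = 0" by (rule quadratic_relation_trivial(1)[of k D ?e ?a ?b ?c ?d, OF 0])
qed

text \<open>
  Comparing the discriminants of the two proportional quadratic forms gives
  \<open>(T\<^sup>2 - 4) \<kappa>\<^sup>2 = \<mu>\<^sup>2 (z\<^sup>2 - 4)\<close>, which forces \<open>\<mu>\<close> to be constant and \<open>T = \<plusminus>z\<close>.
\<close>

lemma conic_discriminant:
  fixes b1 b2 c1 c2 T \<mu> :: "complex poly"
  assumes "b1\<^sup>2 + b2\<^sup>2 + T * b1 * b2 = \<mu>" "c1\<^sup>2 + c2\<^sup>2 + T * c1 * c2 = \<mu>"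
    "2 * b1 * c1 + 2 * b2 * c2 + T * (b1 * c2 + b2 * c1) = [:0, 1:] * \<mu>"
    and \<kappa>: "b1 * c2 - b2 * c1 = [:\<kappa>:]" "\<kappa> \<noteq> 0" and T: "T = [:\<beta>, \<alpha>:]" "\<alpha> \<noteq> 0"
  obtains l where "\<mu> = [:l:]" "l \<noteq> 0" "\<beta> = 0" "\<alpha>\<^sup>2 = 1" "\<kappa>\<^sup>2 = l\<^sup>2"
proof -
  have "(2 * b1 * c1 + 2 * b2 * c2 + T * (b1 * c2 + b2 * c1))\<^sup>2
        - 4 * (b1\<^sup>2 + b2\<^sup>2 + T * b1 * b2) * (c1\<^sup>2 + c2\<^sup>2 + T * c1 * c2)
      = (T\<^sup>2 - 4) * (b1 * c2 - b2 * c1)\<^sup>2"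
    by (simp only: power2_eq_square) algebra
  then have eq: "(T\<^sup>2 - 4) * [:\<kappa>:]\<^sup>2 = \<mu>\<^sup>2 * ([:0, 1:]\<^sup>2 - 4)"
    unfolding assms(1-3) \<kappa>(1) by (simp only: power2_eq_square) algebra
  have T4: "T\<^sup>2 - 4 = [:\<beta>\<^sup>2 - 4, 2 * \<alpha> * \<beta>, \<alpha>\<^sup>2:]"
    by (simp add: T power2_eq_square numeral_poly algebra_simps)
  have z4: "[:0, 1:]\<^sup>2 - 4 = ([:-4, 0, 1:] :: complex poly)"
    by (simp add: power2_eq_square numeral_poly)
  have eq': "[:(\<beta>\<^sup>2 - 4) * \<kappa>\<^sup>2, 2 * \<alpha> * \<beta> * \<kappa>\<^sup>2, \<alpha>\<^sup>2 * \<kappa>\<^sup>2:] = \<mu>\<^sup>2 * [:-4, 0, 1:]"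
    using eq unfolding T4 z4 by (simp add: power2_eq_square algebra_simps)
  have "\<mu> \<noteq> 0" using eq' T \<kappa> by auto
  then have "degree (\<mu>\<^sup>2 * [:-4, 0, 1:]) = 2 * degree \<mu> + 2"
    by (subst degree_mult_eq) (simp_all add: degree_power_eq)
  moreover have "degree [:(\<beta>\<^sup>2 - 4) * \<kappa>\<^sup>2, 2 * \<alpha> * \<beta> * \<kappa>\<^sup>2, \<alpha>\<^sup>2 * \<kappa>\<^sup>2:] = 2" using T \<kappa> by simp
  ultimately have "degree \<mu> = 0" unfolding eq' by simp
  then obtain l where l: "\<mu> = [:l:]" by (rule degree_eq_zeroE)
  then have l0: "l \<noteq> 0" using \<open>\<mu> \<noteq> 0\<close> by simp
  have "[:(\<beta>\<^sup>2 - 4) * \<kappa>\<^sup>2, 2 * \<alpha> * \<beta> * \<kappa>\<^sup>2, \<alpha>\<^sup>2 * \<kappa>\<^sup>2:] = [:-4 * l\<^sup>2, 0, l\<^sup>2:]"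
    using eq' unfolding l by (simp add: power2_eq_square)
  then have c: "(\<beta>\<^sup>2 - 4) * \<kappa>\<^sup>2 = -4 * l\<^sup>2" "2 * \<alpha> * \<beta> * \<kappa>\<^sup>2 = 0" "\<alpha>\<^sup>2 * \<kappa>\<^sup>2 = l\<^sup>2" by simp_all
  then have "\<beta> = 0" using T \<kappa> by auto
  then have "\<kappa>\<^sup>2 = l\<^sup>2" using c(1) by simp
  then have "\<alpha>\<^sup>2 = 1" using c(3) l0 by simp
  show thesis by (rule that) fact+
qed

section \<open>Descent to signed permutations\<close>

text \<open>
  The descent for the Pell-type equation: \<open>b\<^sub>1 (- b\<^sub>1 - T b\<^sub>2) = b\<^sub>2\<^sup>2 - l\<close>, and the degrees of \<open>b\<^sub>1\<close> and \<open>b\<^sub>2\<close>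
  differ because the degree of \<open>T b\<^sub>1 b\<^sub>2\<close> would otherwise be larger than that of all other terms.
\<close>

lemma conic_descent:
  fixes b1 b2 :: "complex poly"
  assumes eq: "b1\<^sup>2 + b2\<^sup>2 + [:0, \<alpha>:] * b1 * b2 = [:l:]" and "\<alpha> \<noteq> 0" "b1 \<noteq> 0" "b2 \<noteq> 0"
    and le: "degree b2 \<le> degree b1"
  shows "degree (- b1 - [:0, \<alpha>:] * b2) < degree b1"
proof -
  have T: "degree ([:0, \<alpha>:] * b) = Suc (degree b)" if "b \<noteq> 0" for b
    using that \<open>\<alpha> \<noteq> 0\<close> by (subst degree_mult_eq) auto
  have sq: "degree (b\<^sup>2) = 2 * degree b" for b :: "complex poly"
    by (cases "b = 0") (simp_all add: degree_power_eq)
  have lt: "degree b2 < degree b1"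
  proof (rule ccontr)
    assume "\<not> ?thesis"
    then have e: "degree b2 = degree b1" using le by simp
    have "degree ([:0, \<alpha>:] * b1 * b2) = 2 * degree b1 + 1"
      using T[OF \<open>b1 \<noteq> 0\<close>] \<open>b1 \<noteq> 0\<close> \<open>b2 \<noteq> 0\<close> \<open>\<alpha> \<noteq> 0\<close> e by (subst degree_mult_eq) auto
    moreover have "[:0, \<alpha>:] * b1 * b2 = [:l:] - (b1\<^sup>2 + b2\<^sup>2)"
      using eq by (simp only: eq_diff_eq add.commute add.left_commute)
    moreover have "degree ([:l:] - (b1\<^sup>2 + b2\<^sup>2)) \<le> 2 * degree b1"
      by (intro degree_diff_le degree_add_le) (simp_all add: sq e)
    ultimately show False by (metis Suc_eq_plus1 not_less_eq_eq order_refl)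
  qed
  define b where "b = - b1 - [:0, \<alpha>:] * b2"
  have "b1 * b = b2\<^sup>2 - [:l:]" using eq by (simp add: b_def algebra_simps power2_eq_square)
  moreover have "degree (b2\<^sup>2 - [:l:]) \<le> 2 * degree b2" by (intro degree_diff_le) (simp_all add: sq)
  ultimately have "b = 0 \<or> degree b1 + degree b \<le> 2 * degree b2"
    using \<open>b1 \<noteq> 0\<close> degree_mult_eq[of b1 b] by metis
  then show ?thesis using lt unfolding b_def[symmetric] by auto
qed

lemma affine_part_zero:
  fixes a1 a2 :: "complex poly"
  assumes "2 * a1 + [:0, \<alpha>:] * a2 = [:p:]" "2 * a2 + [:0, \<alpha>:] * a1 = [:q:]" "\<alpha> \<noteq> 0"
  shows "a1 = 0" "a2 = 0"
proof -
  have deg: "degree a = degree b + 1" if "2 * a + [:0, \<alpha>:] * b = [:r:]" "b \<noteq> 0" for a b r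
  proof -
    have "degree ([:0, \<alpha>:] * b) = Suc (degree b)" using that(2) \<open>\<alpha> \<noteq> 0\<close> by (subst degree_mult_eq) auto
    then have "degree ([:r:] + - ([:0, \<alpha>:] * b)) = degree (- ([:0, \<alpha>:] * b))"
      by (intro degree_add_eq_right) (simp only: degree_minus, simp)
    also have "\<dots> = Suc (degree b)" by (simp only: degree_minus \<open>degree ([:0, \<alpha>:] * b) = Suc (degree b)\<close>)
    finally have "degree ([:r:] + - ([:0, \<alpha>:] * b)) = Suc (degree b)" .
    moreover have "[:r:] + - ([:0, \<alpha>:] * b) = 2 * a"
      using that(1) by (metis add_diff_cancel_right' diff_conv_add_uminus)
    moreover have "degree (2 * a) = degree a" by (simp add: numeral_poly)
    ultimately show ?thesis by (metis Suc_eq_plus1)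
  qed
  show "a1 = 0"
  proof (rule ccontr)
    assume "a1 \<noteq> 0"
    then have d: "degree a2 = degree a1 + 1" by (rule deg[OF assms(2)])
    then have "a2 \<noteq> 0" by auto
    then have "degree a1 = degree a2 + 1" by (rule deg[OF assms(1)])
    with d show False by linarith
  qed
  show "a2 = 0"
  proof (rule ccontr)
    assume "a2 \<noteq> 0"
    then have d: "degree a1 = degree a2 + 1" by (rule deg[OF assms(1)])
    then have "a1 \<noteq> 0" by auto
    then have "degree a2 = degree a1 + 1" by (rule deg[OF assms(2)])
    with d show False by linarith
  qed
qed

lemma fibration_diagonal:
  assumes P: "surface_iso k D k' D' \<phi> \<psi>" and d: "fdeg k D (\<lambda>v. \<phi> v $ 3) = 0"
    and rep1: "\<And>v. v \<in> surf k D \<Longrightarrow> \<phi> v $ 1 = poly a1 (v $ 3) + poly b1 (v $ 3) * v $ 1 + poly c1 (v $ 3) * v $ 2"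
    and rep2: "\<And>v. v \<in> surf k D \<Longrightarrow> \<phi> v $ 2 = poly a2 (v $ 3) + poly b2 (v $ 3) * v $ 1 + poly c2 (v $ 3) * v $ 2"
  shows "\<exists>\<alpha> l \<kappa>. (\<forall>v\<in>surf k D. \<phi> v $ 3 = \<alpha> * v $ 3) \<and> \<alpha>\<^sup>2 = 1 \<and> \<alpha> \<noteq> 0 \<and> l \<noteq> 0 \<and>
    b1\<^sup>2 + b2\<^sup>2 + [:0, \<alpha>:] * b1 * b2 = [:l:] \<and> c1\<^sup>2 + c2\<^sup>2 + [:0, \<alpha>:] * c1 * c2 = [:l:] \<and>
    b1 * c2 - b2 * c1 = [:\<kappa>:] \<and> \<kappa> \<noteq> 0 \<and> \<kappa>\<^sup>2 = l\<^sup>2"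
proof -
  obtain \<alpha> \<beta> where ab: "\<alpha> \<noteq> 0" "\<And>v. v \<in> surf k D \<Longrightarrow> \<phi> v $ 3 = \<alpha> * v $ 3 + \<beta>"
    using fibration_affine[OF P d] by blast
  define T where "T = [:\<beta>, \<alpha>:]"
  have rep3: "\<phi> v $ 3 = poly T (v $ 3)" if "v \<in> surf k D" for v using ab(2)[OF that] by (simp add: T_def)
  obtain \<kappa> where \<kappa>: "\<kappa> \<noteq> 0" "b1 * c2 - b2 * c1 = [:\<kappa>:]"
    using fibration_determinant[OF P d rep1 rep2] by blast
  note E = fibration_equations[OF P rep1 rep2 rep3 refl]
  obtain l where l: "c1\<^sup>2 + c2\<^sup>2 + T * c1 * c2 = [:l:]" "l \<noteq> 0" "\<beta> = 0" "\<alpha>\<^sup>2 = 1" "\<kappa>\<^sup>2 = l\<^sup>2"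
    using conic_discriminant[OF E(1) refl E(2) \<kappa>(2,1) T_def ab(1)] by blast
  have "b1\<^sup>2 + b2\<^sup>2 + T * b1 * b2 = [:l:]" using E(1) l(1) by simp
  moreover have "T = [:0, \<alpha>:]" "\<forall>v\<in>surf k D. \<phi> v $ 3 = \<alpha> * v $ 3"
    using l(3) ab(2) by (simp_all add: T_def)
  ultimately show ?thesis
    using l ab(1) \<kappa> by (intro exI[of _ \<alpha>] exI[of _ l] exI[of _ \<kappa>] conjI) simp_all
qed

lemma reducible_diagonal:
  assumes P: "surface_iso k D k' D' \<phi> \<psi>" and d: "fdeg k D (\<lambda>v. \<phi> v $ 3) = 0"
    and rep1: "\<And>v. v \<in> surf k D \<Longrightarrow> \<phi> v $ 1 = poly a1 (v $ 3) + poly [:\<mu>:] (v $ 3) * v $ 1 + poly 0 (v $ 3) * v $ 2"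
    and rep2: "\<And>v. v \<in> surf k D \<Longrightarrow> \<phi> v $ 2 = poly a2 (v $ 3) + poly 0 (v $ 3) * v $ 1 + poly [:\<nu>:] (v $ 3) * v $ 2"
  shows "reducible_to_linear k D k' \<phi>"
proof -
  obtain \<alpha> l \<kappa> where 3: "\<And>v. v \<in> surf k D \<Longrightarrow> \<phi> v $ 3 = \<alpha> * v $ 3" "\<alpha>\<^sup>2 = 1" "\<alpha> \<noteq> 0" "l \<noteq> 0"
    and l: "[:\<mu>:]\<^sup>2 + 0\<^sup>2 + [:0, \<alpha>:] * [:\<mu>:] * 0 = [:l:]" "0\<^sup>2 + [:\<nu>:]\<^sup>2 + [:0, \<alpha>:] * 0 * [:\<nu>:] = [:l:]"
    using fibration_diagonal[OF P d rep1 rep2] by blast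
  have mn: "\<mu>\<^sup>2 = l" "\<nu>\<^sup>2 = l" using l by (simp_all add: power2_eq_square)
  have mn0: "\<mu> \<noteq> 0" "\<nu> \<noteq> 0" using mn 3 by auto
  have rep3: "\<phi> v $ 3 = poly [:0, \<alpha>:] (v $ 3)" if "v \<in> surf k D" for v using 3(1) that by simp
  note E = fibration_equations[OF P rep1 rep2 rep3 l(2)[symmetric]]
  have "\<alpha> * \<mu> * \<nu> = l" using E(2) by (simp add: mult_ac)
  have lm: "[:l:] = [:\<mu>:] * [:\<mu>:]" "[:l:] = [:\<nu>:] * [:\<nu>:]"
    using mn by (simp_all add: power2_eq_square)
  have "[:\<mu>:] * (2 * a1 + [:0, \<alpha>:] * a2 - [:k' $ 1:] + [:\<mu>:] * [:k $ 1:]) = 0"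
    using E(3) unfolding lm(1) by algebra
  then have "2 * a1 + [:0, \<alpha>:] * a2 - [:k' $ 1:] + [:\<mu>:] * [:k $ 1:] = 0"
    using mn0 by (simp only: mult_eq_0_iff pCons_eq_0_iff) simp
  then have "2 * a1 + [:0, \<alpha>:] * a2 = [:k' $ 1:] - [:\<mu>:] * [:k $ 1:]" by algebra
  then have 1: "2 * a1 + [:0, \<alpha>:] * a2 = [:k' $ 1 - \<mu> * k $ 1:]" by simp
  have "[:\<nu>:] * (2 * a2 + [:0, \<alpha>:] * a1 - [:k' $ 2:] + [:\<nu>:] * [:k $ 2:]) = 0"
    using E(4) unfolding lm(2) by algebra
  then have "2 * a2 + [:0, \<alpha>:] * a1 - [:k' $ 2:] + [:\<nu>:] * [:k $ 2:] = 0"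
    using mn0 by (simp only: mult_eq_0_iff pCons_eq_0_iff) simp
  then have "2 * a2 + [:0, \<alpha>:] * a1 = [:k' $ 2:] - [:\<nu>:] * [:k $ 2:]" by algebra
  then have 2: "2 * a2 + [:0, \<alpha>:] * a1 = [:k' $ 2 - \<nu> * k $ 2:]" by simp
  have a: "a1 = 0" "a2 = 0" using affine_part_zero[OF 1 2 3(3)] by auto
  have "l = 1" using E(5) 3(2) by (simp add: a power2_eq_square)
  then have s: "\<mu> = 1 \<or> \<mu> = -1" "\<nu> = 1 \<or> \<nu> = -1" "\<alpha> = 1 \<or> \<alpha> = -1" "\<alpha> * \<mu> * \<nu> = 1"
    using mn 3(2) \<open>\<alpha> * \<mu> * \<nu> = l\<close> by (auto simp: power2_eq_1_iff)
  define e where "e = (\<lambda>j. (vector [\<mu>, \<nu>, \<alpha>] :: complex ^ 3) $ j)"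
  have "even_signs e"
    using s by (simp add: even_signs_def forall_3 prod_UNIV_3 e_def mult_ac)
  moreover have "\<phi> v = signed_perm id e v" if "v \<in> surf k D" for v
    using rep1[OF that] rep2[OF that] 3(1)[rule_format, OF that]
    by (simp add: vec_eq_iff forall_3 signed_perm_def e_def a)
  ultimately show ?thesis
    unfolding reducible_to_linear_def by (intro exI[of _ "[]"] exI[of _ id] exI[of _ e]) simp
qed

lemma vieta_rep:
  fixes u v :: "complex ^ 3"
  assumes "u $ 1 = poly a1 (v $ 3) + poly b1 (v $ 3) * v $ 1 + poly c1 (v $ 3) * v $ 2"
    and "u $ 2 = poly a2 (v $ 3) + poly b2 (v $ 3) * v $ 1 + poly c2 (v $ 3) * v $ 2"
    and "u $ 3 = \<alpha> * v $ 3"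
  shows "vieta k' 1 u $ 1 = poly ([:k' $ 1:] - a1 - [:0, \<alpha>:] * a2) (v $ 3)
      + poly (- b1 - [:0, \<alpha>:] * b2) (v $ 3) * v $ 1 + poly (- c1 - [:0, \<alpha>:] * c2) (v $ 3) * v $ 2"
    and "vieta k' 2 u $ 2 = poly ([:k' $ 2:] - a2 - [:0, \<alpha>:] * a1) (v $ 3)
      + poly (- b2 - [:0, \<alpha>:] * b1) (v $ 3) * v $ 1 + poly (- c2 - [:0, \<alpha>:] * c1) (v $ 3) * v $ 2"
  using assms by (simp_all add: vieta_simps algebra_simps)

text \<open>
  If \<open>b\<^sub>2 = 0\<close>, then \<open>b\<^sub>1\<close> and \<open>c\<^sub>2\<close> are constant and \<open>c\<^sub>1 (c\<^sub>1 + T c\<^sub>2) = 0\<close>: the map is diagonal up to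
  translations, either itself or after the first involution.
\<close>

lemma reducible_triangular:
  assumes P: "surface_iso k D k' D' \<phi> \<psi>" and d: "fdeg k D (\<lambda>v. \<phi> v $ 3) = 0"
    and rep1: "\<And>v. v \<in> surf k D \<Longrightarrow> \<phi> v $ 1 = poly a1 (v $ 3) + poly b1 (v $ 3) * v $ 1 + poly c1 (v $ 3) * v $ 2"
    and rep2: "\<And>v. v \<in> surf k D \<Longrightarrow> \<phi> v $ 2 = poly a2 (v $ 3) + poly 0 (v $ 3) * v $ 1 + poly c2 (v $ 3) * v $ 2"
  shows "reducible_to_linear k D k' \<phi>"
proof -
  obtain \<alpha> l \<kappa> where 3: "\<And>v. v \<in> surf k D \<Longrightarrow> \<phi> v $ 3 = \<alpha> * v $ 3" "\<alpha>\<^sup>2 = 1" "\<alpha> \<noteq> 0" "l \<noteq> 0"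
    and l: "b1\<^sup>2 + 0\<^sup>2 + [:0, \<alpha>:] * b1 * 0 = [:l:]" "c1\<^sup>2 + c2\<^sup>2 + [:0, \<alpha>:] * c1 * c2 = [:l:]"
    and \<kappa>: "b1 * c2 - 0 * c1 = [:\<kappa>:]" "\<kappa> \<noteq> 0" "\<kappa>\<^sup>2 = l\<^sup>2"
    using fibration_diagonal[OF P d rep1 rep2] by blast
  have bl: "b1\<^sup>2 = [:l:]" and bc: "b1 * c2 = [:\<kappa>:]" using l(1) \<kappa>(1) by simp_all
  have "b1 \<noteq> 0" "c2 \<noteq> 0" using bc \<kappa>(2) by auto
  then have "degree b1 + degree c2 = 0" using bc by (metis degree_mult_eq degree_pCons_0)
  then obtain \<mu> \<nu> where mn: "b1 = [:\<mu>:]" "c2 = [:\<nu>:]" by (auto elim!: degree_eq_zeroE)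
  have m: "\<mu>\<^sup>2 = l" "\<mu> * \<nu> = \<kappa>" using bl bc by (simp_all add: mn power2_eq_square mult.commute)
  then have "l * \<nu>\<^sup>2 = l * l" using \<kappa>(3) by (metis power2_eq_square power_mult_distrib)
  then have "\<nu>\<^sup>2 = l" using 3(4) by simp
  then have "c2\<^sup>2 = [:l:]" by (simp add: mn power2_eq_square)
  have "c1 * (c1 + [:0, \<alpha>:] * c2) = 0"
  proof -
    have "c1 * (c1 + [:0, \<alpha>:] * c2) = (c1\<^sup>2 + c2\<^sup>2 + [:0, \<alpha>:] * c1 * c2) - c2\<^sup>2" by algebra
    then show ?thesis unfolding l(2) by (simp only: \<open>c2\<^sup>2 = [:l:]\<close> diff_self)
  qed
  moreover have "- c1 - [:0, \<alpha>:] * c2 = - (c1 + [:0, \<alpha>:] * c2)"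
    by (simp only: minus_add_distrib diff_conv_add_uminus)
  ultimately consider "c1 = 0" | "- c1 - [:0, \<alpha>:] * c2 = 0"
    by (metis mult_eq_0_iff neg_equal_0_iff_equal)
  then show ?thesis
  proof cases
    case 1
    show ?thesis by (rule reducible_diagonal[OF P d rep1[unfolded 1 mn] rep2[unfolded mn]])
  next
    case 2
    let ?\<phi> = "\<lambda>v. vieta k' 1 (\<phi> v)"
    have "reducible_to_linear k D k' ?\<phi>"
    proof (rule reducible_diagonal[OF surface_iso_vieta[OF P, of 1]])
      show "fdeg k D (\<lambda>v. ?\<phi> v $ 3) = 0" using d by (simp add: vieta_simps)
      show "?\<phi> v $ 1 = poly ([:k' $ 1:] - a1 - [:0, \<alpha>:] * a2) (v $ 3) + poly [:- \<mu>:] (v $ 3) * v $ 1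
          + poly 0 (v $ 3) * v $ 2" if "v \<in> surf k D" for v
        using vieta_rep(1)[OF rep1[OF that] rep2[OF that] 3(1)[rule_format, OF that], of k']
        unfolding 2 by (simp add: mn)
      show "?\<phi> v $ 2 = poly a2 (v $ 3) + poly 0 (v $ 3) * v $ 1 + poly [:\<nu>:] (v $ 3) * v $ 2"
        if "v \<in> surf k D" for v
        using rep2[OF that] by (simp add: mn vieta_simps)
    qed
    then show ?thesis by (rule reducible_vieta)
  qed
qed

lemma reducible_fibration_coeffs:
  assumes "surface_iso k D k' D' \<phi> \<psi>" and "fdeg k D (\<lambda>v. \<phi> v $ 3) = 0"
    and "\<And>v. v \<in> surf k D \<Longrightarrow> \<phi> v $ 1 = poly a1 (v $ 3) + poly b1 (v $ 3) * v $ 1 + poly c1 (v $ 3) * v $ 2"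
    and "\<And>v. v \<in> surf k D \<Longrightarrow> \<phi> v $ 2 = poly a2 (v $ 3) + poly b2 (v $ 3) * v $ 1 + poly c2 (v $ 3) * v $ 2"
  shows "reducible_to_linear k D k' \<phi>"
  using assms
proof (induction "degree b1 + degree b2" arbitrary: \<phi> \<psi> a1 b1 c1 a2 b2 c2 rule: less_induct)
  case less
  note P = less.prems(1) and d = less.prems(2) and rep1 = less.prems(3) and rep2 = less.prems(4)
  obtain \<alpha> l \<kappa> where 3: "\<And>v. v \<in> surf k D \<Longrightarrow> \<phi> v $ 3 = \<alpha> * v $ 3" "\<alpha>\<^sup>2 = 1" "\<alpha> \<noteq> 0" "l \<noteq> 0"
    and l: "b1\<^sup>2 + b2\<^sup>2 + [:0, \<alpha>:] * b1 * b2 = [:l:]"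
    using fibration_diagonal[OF P d rep1 rep2] by blast
  note \<phi>3 = 3(1)[rule_format]
  consider "b2 = 0" | "b1 = 0" | "b1 \<noteq> 0" "b2 \<noteq> 0" "degree b2 \<le> degree b1"
    | "b1 \<noteq> 0" "b2 \<noteq> 0" "degree b1 \<le> degree b2" by linarith
  then show ?case
  proof cases
    case 1
    then show ?thesis using reducible_triangular[OF P d rep1] rep2 by simp
  next
    case 2
    let ?t = "Transposition.transpose 1 (2 :: 3)"
    have t: "?t 1 = 2" "?t 2 = 1" "?t 3 = 3" by (simp_all add: Transposition.transpose_def)
    have "reducible_to_linear k D (permute_coords ?t k') (\<lambda>v. permute_coords ?t (\<phi> v))"
    proof (rule reducible_triangular[OF surface_iso_perm[OF P, of ?t]])
      show "permute_coords ?t (\<phi> v) $ 1 = poly a2 (v $ 3) + poly b2 (v $ 3) * v $ 1 + poly c2 (v $ 3) * v $ 2"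
        if "v \<in> surf k D" for v using rep2[OF that] by (simp add: permute_coords_def t)
      show "permute_coords ?t (\<phi> v) $ 2 = poly a1 (v $ 3) + poly 0 (v $ 3) * v $ 1 + poly c1 (v $ 3) * v $ 2"
        if "v \<in> surf k D" for v using rep1[OF that] by (simp add: permute_coords_def t 2)
    qed (use d in \<open>simp_all add: permute_coords_def t\<close>)
    then show ?thesis by (rule reducible_perm) simp_all
  next
    case 3
    let ?\<phi> = "\<lambda>v. vieta k' 1 (\<phi> v)"
    have "reducible_to_linear k D k' ?\<phi>"
    proof (rule less.hyps[OF _ surface_iso_vieta[OF P, of 1]])
      show "?\<phi> v $ 1 = poly ([:k' $ 1:] - a1 - [:0, \<alpha>:] * a2) (v $ 3)
          + poly (- b1 - [:0, \<alpha>:] * b2) (v $ 3) * v $ 1 + poly (- c1 - [:0, \<alpha>:] * c2) (v $ 3) * v $ 2"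
        if "v \<in> surf k D" for v by (rule vieta_rep(1)[OF rep1[OF that] rep2[OF that] \<phi>3[OF that]])
      show "degree (- b1 - [:0, \<alpha>:] * b2) + degree b2 < degree b1 + degree b2"
        using conic_descent[OF l \<open>\<alpha> \<noteq> 0\<close> 3] by simp
      show "?\<phi> v $ 2 = poly a2 (v $ 3) + poly b2 (v $ 3) * v $ 1 + poly c2 (v $ 3) * v $ 2"
        if "v \<in> surf k D" for v using rep2[OF that] by (simp add: vieta_simps)
    qed (use d in \<open>simp_all add: vieta_simps\<close>)
    then show ?thesis by (rule reducible_vieta)
  next
    case 4
    let ?\<phi> = "\<lambda>v. vieta k' 2 (\<phi> v)"
    have l': "b2\<^sup>2 + b1\<^sup>2 + [:0, \<alpha>:] * b2 * b1 = [:l:]" using l by (simp add: algebra_simps)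
    have "reducible_to_linear k D k' ?\<phi>"
    proof (rule less.hyps[OF _ surface_iso_vieta[OF P, of 2]])
      show "?\<phi> v $ 2 = poly ([:k' $ 2:] - a2 - [:0, \<alpha>:] * a1) (v $ 3)
          + poly (- b2 - [:0, \<alpha>:] * b1) (v $ 3) * v $ 1 + poly (- c2 - [:0, \<alpha>:] * c1) (v $ 3) * v $ 2"
        if "v \<in> surf k D" for v by (rule vieta_rep(2)[OF rep1[OF that] rep2[OF that] \<phi>3[OF that]])
      show "degree b1 + degree (- b2 - [:0, \<alpha>:] * b1) < degree b1 + degree b2"
        using conic_descent[OF l' \<open>\<alpha> \<noteq> 0\<close> 4(2,1,3)] by simp
      show "?\<phi> v $ 1 = poly a1 (v $ 3) + poly b1 (v $ 3) * v $ 1 + poly c1 (v $ 3) * v $ 2"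
        if "v \<in> surf k D" for v using rep1[OF that] by (simp add: vieta_simps)
    qed (use d in \<open>simp_all add: vieta_simps\<close>)
    then show ?thesis by (rule reducible_vieta)
  qed
qed

lemma reducible_fibration:
  assumes P: "surface_iso k D k' D' \<phi> \<psi>" and d: "fdeg k D (\<lambda>v. \<phi> v $ 3) = 0"
  shows "reducible_to_linear k D k' \<phi>"
proof -
  have rp: "regular k D (\<lambda>v. \<phi> v $ i)" for i using P by (auto simp: surface_iso_def)
  have "fdeg k D (\<lambda>v. \<phi> v $ 1) \<le> 1" "fdeg k D (\<lambda>v. \<phi> v $ 2) \<le> 1"
    using fibration_degree_1(1)[OF P d] by auto
  from fdeg_le_1[OF rp this(1)] fdeg_le_1[OF rp this(2)] show ?thesis
    using reducible_fibration_coeffs[OF P d] by metis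
qed

text \<open>
  Induction on the sum of the degrees of the components: either one of them is 0, and a transposition
  of the target coordinates makes it the third, or an involution lowers the sum.
\<close>

theorem isomorphism_reducible:
  assumes "surface_iso k D k' D' \<phi> \<psi>"
  shows "reducible_to_linear k D k' \<phi>"
  using assms
proof (induction "\<Sum>i\<in>UNIV. fdeg k D (\<lambda>v. \<phi> v $ i)" arbitrary: \<phi> \<psi> rule: less_induct)
  case less
  note P = less.prems
  have rp: "regular k D (\<lambda>v. \<phi> v $ i)" for i using P by (auto simp: surface_iso_def)
  show ?case
  proof (cases "\<exists>i. fdeg k D (\<lambda>v. \<phi> v $ i) = 0")
    case True
    then obtain i where i: "fdeg k D (\<lambda>v. \<phi> v $ i) = 0" ..
    let ?t = "Transposition.transpose i (3 :: 3)"
    have "reducible_to_linear k D (permute_coords ?t k') (\<lambda>v. permute_coords ?t (\<phi> v))"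
      by (rule reducible_fibration[OF surface_iso_perm[OF P, of ?t]]) (use i in \<open>simp_all add: permute_coords_def\<close>)
    then show ?thesis by (rule reducible_perm) simp_all
  next
    case False
    then have pos: "fdeg k D (\<lambda>v. \<phi> v $ i) > 0" for i by simp
    have "\<exists>i. fdeg k D (\<lambda>v. vieta k' i (\<phi> v) $ i) < fdeg k D (\<lambda>v. \<phi> v $ i)"
    proof -
      consider "fdeg k D (\<lambda>v. \<phi> v $ 2) \<le> fdeg k D (\<lambda>v. \<phi> v $ 1)" "fdeg k D (\<lambda>v. \<phi> v $ 3) \<le> fdeg k D (\<lambda>v. \<phi> v $ 1)"
        | "fdeg k D (\<lambda>v. \<phi> v $ 1) \<le> fdeg k D (\<lambda>v. \<phi> v $ 2)" "fdeg k D (\<lambda>v. \<phi> v $ 3) \<le> fdeg k D (\<lambda>v. \<phi> v $ 2)"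
        | "fdeg k D (\<lambda>v. \<phi> v $ 1) \<le> fdeg k D (\<lambda>v. \<phi> v $ 3)" "fdeg k D (\<lambda>v. \<phi> v $ 2) \<le> fdeg k D (\<lambda>v. \<phi> v $ 3)"
        by linarith
      then show ?thesis
      proof cases
        case 1
        have "fdeg k D (\<lambda>v. k' $ 1 - \<phi> v $ 1 - \<phi> v $ 2 * \<phi> v $ 3) < fdeg k D (\<lambda>v. \<phi> v $ 1)"
          by (rule markov_vieta_degree[OF rp rp rp _ pos pos pos 1,
                where b = "k' $ 2" and c = "k' $ 3" and d = D'])
            (use surface_iso_markov[OF P] in \<open>simp add: algebra_simps\<close>)
        then show ?thesis by (intro exI[of _ 1]) (simp add: vieta_simps)
      next
        case 2
        have "fdeg k D (\<lambda>v. k' $ 2 - \<phi> v $ 2 - \<phi> v $ 1 * \<phi> v $ 3) < fdeg k D (\<lambda>v. \<phi> v $ 2)"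
          by (rule markov_vieta_degree[OF rp rp rp _ pos pos pos 2,
                where b = "k' $ 1" and c = "k' $ 3" and d = D'])
            (use surface_iso_markov[OF P] in \<open>simp add: algebra_simps\<close>)
        then show ?thesis by (intro exI[of _ 2]) (simp add: vieta_simps)
      next
        case 3
        have "fdeg k D (\<lambda>v. k' $ 3 - \<phi> v $ 3 - \<phi> v $ 1 * \<phi> v $ 2) < fdeg k D (\<lambda>v. \<phi> v $ 3)"
          by (rule markov_vieta_degree[OF rp rp rp _ pos pos pos 3,
                where b = "k' $ 1" and c = "k' $ 2" and d = D'])
            (use surface_iso_markov[OF P] in \<open>simp add: algebra_simps\<close>)
        then show ?thesis by (intro exI[of _ 3]) (simp add: vieta_simps)
      qed
    qed
    then obtain i where i: "fdeg k D (\<lambda>v. vieta k' i (\<phi> v) $ i) < fdeg k D (\<lambda>v. \<phi> v $ i)" ..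
    have "(\<Sum>j\<in>UNIV. fdeg k D (\<lambda>v. vieta k' i (\<phi> v) $ j)) < (\<Sum>j\<in>UNIV. fdeg k D (\<lambda>v. \<phi> v $ j))"
    proof (rule sum_strict_mono_ex1)
      show "\<forall>j\<in>UNIV. fdeg k D (\<lambda>v. vieta k' i (\<phi> v) $ j) \<le> fdeg k D (\<lambda>v. \<phi> v $ j)"
      proof
        fix j
        show "fdeg k D (\<lambda>v. vieta k' i (\<phi> v) $ j) \<le> fdeg k D (\<lambda>v. \<phi> v $ j)"
        proof (cases "j = i")
          case False
          then have "vieta k' i u $ j = u $ j" for u by (simp add: vieta_def)
          then show ?thesis by simp
        qed (use i in simp)
      qed
    qed (use i in auto)
    then have "reducible_to_linear k D k' (\<lambda>v. vieta k' i (\<phi> v))"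
      by (rule less.hyps) (rule surface_iso_vieta[OF P])
    then show ?thesis by (rule reducible_vieta)
  qed
qed

section \<open>The group and its action\<close>

text \<open>The element of \<open>PGL(2, \<int>)\<close> defined by a word.\<close>

definition word_class :: "3 list \<Rightarrow> (int ^ 2 ^ 2) set" where
  "word_class w = {wmat w, - wmat w}"

lemma GL2Z_simps [simp]: "x \<otimes>\<^bsub>GL2Z\<^esub> y = x ** y" "\<one>\<^bsub>GL2Z\<^esub> = mat 1"
  by (simp_all add: GL2Z_def units_of_def)

lemma carrier_GL2Z: "M \<in> carrier GL2Z \<longleftrightarrow> (\<exists>N. N ** M = mat 1 \<and> M ** N = mat 1)"
  by (auto simp: GL2Z_def units_of_def Units_def)

lemma proj_class_eq: "proj_class M = {M, - M}"
  by (auto simp: proj_class_def pm_one_def r_coset_def uminus_matrix_mult)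

lemma gen_classes: "gen_x = word_class [1]" "gen_y = word_class [2]" "gen_z = word_class [3]"
  by (simp_all add: gen_x_def gen_y_def gen_z_def proj_class_eq word_class_def gmat_simps)

lemma mult_Gamma2: "X \<otimes>\<^bsub>Gamma2\<^esub> Y = (\<Union>M\<in>X. \<Union>N\<in>Y. {M ** N})"
  by (simp add: Gamma2_def PGL2Z_def FactGroup_def set_mult_def)

lemma word_class_mult: "word_class u \<otimes>\<^bsub>Gamma2\<^esub> word_class w = word_class (u @ w)"
  by (auto simp: mult_Gamma2 word_class_def wmat_append uminus_matrix_mult)

lemma det_GL2Z:
  assumes "M \<in> carrier GL2Z"
  shows "\<bar>M $ 1 $ 1 * M $ 2 $ 2 - M $ 1 $ 2 * M $ 2 $ 1\<bar> = 1"
proof -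
  obtain N where "M ** N = mat 1" using assms carrier_GL2Z by blast
  then have "det M * det N = 1" by (metis det_mul det_I)
  then have "\<bar>det M\<bar> = 1" by (metis abs_zmult_eq_1 abs_one)
  then show ?thesis by (simp add: det_2)
qed

lemma wmat_mod_2: "[wmat w $ i $ j = mat 1 $ i $ j] (mod 2)"
proof (induction w arbitrary: i j)
  case (Cons l w)
  have "[wmat w $ i $ j = mat 1 $ i $ j] (mod 2)" for i j by (rule Cons)
  then have "\<forall>i j. wmat w $ i $ j mod 2 = mat 1 $ i $ j mod 2" by (simp add: cong_def)
  then show ?case
    using exhaust_3[of l] exhaust_2[of i] exhaust_2[of j]
    by (elim disjE; simp add: cong_def gmat_simps matrix_matrix_mult_def sum_2 forall_2 mat_def; presburger)
qed simp

lemma carrier_Gamma2: "carrier Gamma2 = range word_class"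
proof (intro equalityI subsetI)
  fix X assume "X \<in> carrier Gamma2"
  then obtain M where X: "X \<in> carrier PGL2Z" and M: "M \<in> X" "\<And>i j. [M $ i $ j = mat 1 $ i $ j] (mod 2)"
    by (auto simp: Gamma2_def)
  obtain N where N: "N \<in> carrier GL2Z" "X = pm_one #>\<^bsub>GL2Z\<^esub> N"
    using X by (auto simp: PGL2Z_def FactGroup_def RCOSETS_def)
  then have X_eq: "X = {N, - N}" using proj_class_eq[of N] by (simp add: proj_class_def)
  with M(1) have "M = N \<or> M = - N" by auto
  then have X_M: "X = {M, - M}" and det: "\<bar>M $ 1 $ 1 * M $ 2 $ 2 - M $ 1 $ 2 * M $ 2 $ 1\<bar> = 1"
    using X_eq det_GL2Z[OF N(1)] by auto
  have par: "odd (M $ 1 $ 1)" "even (M $ 1 $ 2)" "even (M $ 2 $ 1)" "odd (M $ 2 $ 2)"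
    using M(2)[of 1 1] M(2)[of 1 2] M(2)[of 2 1] M(2)[of 2 2]
    by (simp_all add: cong_def mat_def even_iff_mod_2_eq_zero odd_iff_mod_2_eq_one)
  have "M = mat2 (M $ 1 $ 1) (M $ 1 $ 2) (M $ 2 $ 1) (M $ 2 $ 2)"
    by (simp add: mat2_def vec_eq_iff forall_2)
  with generated_mat2[OF det par] have "word_generated M" by simp
  then obtain w where "M = wmat w \<or> M = - wmat w" by (auto simp: word_generated_def)
  then have "X = word_class w" using X_M by (auto simp: word_class_def)
  then show "X \<in> range word_class" by simp
next
  fix X assume "X \<in> range word_class"
  then obtain w where X: "X = word_class w" by blast
  have "wmat (rev w) ** wmat w = mat 1 \<and> wmat w ** wmat (rev w) = mat 1"
    using wmat_rev[of w] wmat_rev[of "rev w"] by simp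
  then have "wmat w \<in> carrier GL2Z" using carrier_GL2Z by blast
  moreover have "X = pm_one #>\<^bsub>GL2Z\<^esub> wmat w"
    using proj_class_eq[of "wmat w"] by (simp add: X word_class_def proj_class_def)
  ultimately have "X \<in> carrier PGL2Z" by (auto simp: PGL2Z_def FactGroup_def RCOSETS_def)
  then show "X \<in> carrier Gamma2" using wmat_mod_2 by (auto simp: Gamma2_def X word_class_def)
qed

lemma word_class_eq_imp_wmat:
  assumes "word_class u = word_class w"
  shows "wmat (rev w @ u) = mat 1 \<or> wmat (rev w @ u) = - mat 1"
proof -
  have "wmat u = wmat w \<or> wmat u = - wmat w" using assms by (auto simp: word_class_def)
  then show ?thesis by (auto simp: wmat_append wmat_rev uminus_matrix_mult)
qed

lemma word_class_eq_imp_act: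
  assumes "word_class u = word_class w"
  shows "word_act k u v = word_act k w v"
proof -
  have "word_act k (rev w @ u) v = v"
    by (rule wmat_trivial_imp[OF word_class_eq_imp_wmat[OF assms]])
  then have "word_act k w (word_act k (rev w) (word_act k u v)) = word_act k w v" by (simp add: word_act_append)
  then show ?thesis by simp
qed

lemma word_act_eq_imp_word_class:
  assumes "\<And>v. v \<in> surf k D \<Longrightarrow> word_act k u v = word_act k w v"
  shows "word_class u = word_class w"
proof -
  have "wmat (rev w @ u) = mat 1"
    by (rule word_act_trivial_imp[of k D]) (simp add: word_act_append assms)
  then have "wmat w ** (wmat (rev w) ** wmat u) = wmat w" by (simp add: wmat_append)
  moreover have "wmat w ** wmat (rev w) = mat 1" using wmat_rev[of "rev w"] by simp
  ultimately have "wmat u = wmat w" by (simp add: matrix_mul_assoc)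
  then show ?thesis by (simp add: word_class_def)
qed

lemma polynomial_function_diff:
  assumes "complex_polynomial_function f" "complex_polynomial_function g"
  shows "complex_polynomial_function (\<lambda>v. f v - g v)"
proof -
  have "complex_polynomial_function (\<lambda>v. f v + (-1) * g v)"
    using assms by (intro complex_polynomial_function.intros)
  then show ?thesis by simp
qed

lemma polynomial_map_act: "complex_polynomial_map (word_act k w)"
proof -
  have "complex_polynomial_function (\<lambda>v. word_act k w v $ j)" for j
  proof (induction w arbitrary: j)
    case Nil
    show ?case by (simp add: complex_polynomial_function.coord)
  next
    case (Cons i w)
    show ?case
      using exhaust_3[of i] exhaust_3[of j]
      by (elim disjE; simp add: vieta_simps;
          intro polynomial_function_diff complex_polynomial_function.const
            complex_polynomial_function.mult Cons)
  qed
  then show ?thesis by (simp add: complex_polynomial_map_def)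
qed

lemma bij_betw_act: "bij_betw (word_act k w) (surf k D) (surf k D)"
  by (rule bij_betw_byWitness[where f' = "word_act k (rev w)"]) (auto simp: word_act_in_surf)

lemma mult_poly_Aut:
  "f \<in> Bij S \<Longrightarrow> g \<in> Bij S \<Longrightarrow> f \<otimes>\<^bsub>poly_Aut S\<^esub> g = compose S f g"
  by (simp add: poly_Aut_def BijGroup_def)

lemma carrier_poly_Aut:
  "f \<in> carrier (poly_Aut S) \<longleftrightarrow> f \<in> Bij S \<and> regular_self_map S f \<and> regular_self_map S (inv_into S f)"
  by (simp add: poly_Aut_def)

lemma restrict_act_Bij: "restrict (word_act k w) (surf k D) \<in> Bij (surf k D)"
  using bij_betw_act[of k w D] by (simp add: Bij_def bij_betw_restrict_eq)

lemma restrict_act_poly_Aut: "restrict (word_act k w) (surf k D) \<in> carrier (poly_Aut (surf k D))"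
proof -
  have regular: "regular_self_map (surf k D) f" if "\<And>v. v \<in> surf k D \<Longrightarrow> f v = word_act k u v" for f u
    using that polynomial_map_act[of k u] word_act_in_surf[of _ k D u] by (auto simp: regular_self_map_def)
  have "inv_into (surf k D) (restrict (word_act k w) (surf k D)) v = word_act k (rev w) v" if "v \<in> surf k D" for v
  proof (rule inv_into_f_eq)
    show "inj_on (restrict (word_act k w) (surf k D)) (surf k D)"
      using restrict_act_Bij[of k w D] by (simp add: Bij_def bij_betw_def)
  qed (use that in \<open>auto simp: word_act_in_surf\<close>)
  then show ?thesis
    unfolding carrier_poly_Aut using restrict_act_Bij by (auto intro: regular)
qed

lemma restrict_act_mult:
  "restrict (word_act k u) (surf k D) \<otimes>\<^bsub>poly_Aut (surf k D)\<^esub> restrict (word_act k w) (surf k D)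
    = restrict (word_act k (u @ w)) (surf k D)"
  unfolding mult_poly_Aut[OF restrict_act_Bij restrict_act_Bij]
  by (auto simp: compose_def word_act_append word_act_in_surf restrict_def)

text \<open>
  A morphism with the prescribed values at the generators is determined on all words. The empty word
  needs an argument, since \<^const>\<open>hom\<close> does not mention the unit: it is the product of \<open>s\<^sub>x\<close> with itself.
\<close>

lemma surface_action_unique:
  assumes "is_surface_action A B C D \<phi>"
  shows "\<phi> (word_class w) = restrict (word_act (vector [A, B, C]) w) (cubic_surface A B C D)"
proof -
  let ?k = "vector [A, B, C] :: complex ^ 3"
  let ?S = "surf ?k D"
  have S: "cubic_surface A B C D = ?S" by (rule cubic_surface_eq)
  have hom: "\<phi> (X \<otimes>\<^bsub>Gamma2\<^esub> Y) = \<phi> X \<otimes>\<^bsub>poly_Aut ?S\<^esub> \<phi> Y" if "X \<in> carrier Gamma2" "Y \<in> carrier Gamma2" for X Y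
    using assms that by (simp add: is_surface_action_def hom_def S)
  have inv: "inv_x A = vieta ?k 1" "inv_y B = vieta ?k 2" "inv_z C = vieta ?k 3"
    by (auto simp: fun_eq_iff inv_x_def inv_y_def inv_z_def vieta_simps)
  have gen: "\<phi> (word_class [i]) = restrict (word_act ?k [i]) ?S" for i
    using assms exhaust_3[of i] by (auto simp: is_surface_action_def gen_classes S inv restrict_def)
  have cons: "\<phi> (word_class (i # w)) = restrict (word_act ?k (i # w)) ?S"
    if "\<phi> (word_class w) = restrict (word_act ?k w) ?S" for i w
    using hom[of "word_class [i]" "word_class w"] restrict_act_mult[of ?k D "[i]" w]
    by (simp add: carrier_Gamma2 word_class_mult gen that)
  have "\<phi> (word_class w) = restrict (word_act ?k w) ?S"
  proof (induction w)
    case Nil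
    have "word_class [1, 1] = word_class []" by (simp add: word_class_def gmat_gmat)
    then show ?case using cons[OF gen, of 1 1] by (auto simp: restrict_def fun_eq_iff)
  qed (rule cons)
  then show ?thesis by (simp add: S)
qed

lemma surface_action_exists: "\<exists>\<phi>. is_surface_action A B C D \<phi>"
proof -
  let ?k = "vector [A, B, C] :: complex ^ 3"
  let ?S = "surf ?k D"
  define \<phi> where "\<phi> = (\<lambda>X\<in>carrier Gamma2. restrict (word_act ?k (SOME w. X = word_class w)) ?S)"
  have \<phi>: "\<phi> (word_class w) = restrict (word_act ?k w) ?S" for w
  proof -
    have "word_class w = word_class (SOME u. word_class w = word_class u)" by (rule someI) (rule refl)
    then have "word_act ?k (SOME u. word_class w = word_class u) v = word_act ?k w v" for v
      using word_class_eq_imp_act by metis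
    then show ?thesis by (auto simp: \<phi>_def carrier_Gamma2 restrict_def fun_eq_iff)
  qed
  have "\<phi> \<in> hom Gamma2 (poly_Aut ?S)"
    by (auto simp: hom_def carrier_Gamma2 word_class_mult \<phi> restrict_act_mult restrict_act_poly_Aut)
  moreover have "\<phi> \<in> extensional (carrier Gamma2)" by (simp add: \<phi>_def)
  moreover have "inv_x A = vieta ?k 1" "inv_y B = vieta ?k 2" "inv_z C = vieta ?k 3"
    by (auto simp: fun_eq_iff inv_x_def inv_y_def inv_z_def vieta_simps)
  ultimately have "is_surface_action A B C D \<phi>"
    by (auto simp: is_surface_action_def cubic_surface_eq gen_classes \<phi> restrict_def)
  then show ?thesis by blast
qed

lemma surface_action_determined:
  assumes "is_surface_action A B C D \<phi>" "is_surface_action A B C D \<psi>"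
  shows "\<phi> = \<psi>"
proof (rule extensionalityI[of \<phi> "carrier Gamma2" \<psi>])
  show "\<phi> X = \<psi> X" if "X \<in> carrier Gamma2" for X
    using that surface_action_unique[OF assms(1)] surface_action_unique[OF assms(2)]
    by (auto simp: carrier_Gamma2)
qed (use assms in \<open>simp_all add: is_surface_action_def\<close>)

lemma is_surface_action_surface_action: "is_surface_action A B C D (surface_action A B C D)"
proof -
  obtain \<phi> where "is_surface_action A B C D \<phi>" using surface_action_exists by blast
  then have "\<exists>!\<phi>. is_surface_action A B C D \<phi>" using surface_action_determined by blast
  then show ?thesis unfolding surface_action_def by (rule theI')
qed

lemmas surface_action_word = surface_action_unique[OF is_surface_action_surface_action]

lemma surface_action_mon:
  "surface_action A B C D \<in> mon Gamma2 (poly_Aut (cubic_surface A B C D))"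
proof -
  have "inj_on (surface_action A B C D) (carrier Gamma2)"
  proof (rule inj_onI)
    fix X Y assume "X \<in> carrier Gamma2" "Y \<in> carrier Gamma2"
      and eq: "surface_action A B C D X = surface_action A B C D Y"
    then obtain u w where uw: "X = word_class u" "Y = word_class w" by (auto simp: carrier_Gamma2)
    show "X = Y" unfolding uw
    proof (rule word_act_eq_imp_word_class[of "vector [A, B, C]" D])
      fix v assume "v \<in> surf (vector [A, B, C]) D"
      then show "word_act (vector [A, B, C]) u v = word_act (vector [A, B, C]) w v"
        using fun_cong[OF eq, of v] by (simp add: uw surface_action_word cubic_surface_eq)
    qed
  qed
  then show ?thesis
    using is_surface_action_surface_action[of A B C D] by (simp add: mon_def is_surface_action_def)
qed

section \<open>Automorphisms modulo the action\<close>

lemma automorphism_surface_iso: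
  assumes "f \<in> carrier (poly_Aut (surf k D))"
  shows "surface_iso k D k D f (inv_into (surf k D) f)"
proof -
  let ?S = "surf k D"
  have b: "bij_betw f ?S ?S" and r: "regular_self_map ?S f" "regular_self_map ?S (inv_into ?S f)"
    using assms by (auto simp: carrier_poly_Aut Bij_def)
  have regular: "regular k D (\<lambda>v. g v $ i)" if g: "regular_self_map ?S g" for g i
  proof -
    obtain F where F: "complex_polynomial_map F" "\<forall>v\<in>?S. g v = F v"
      using g unfolding regular_self_map_def by blast
    then have "regular k D (\<lambda>v. F v $ i)"
      by (auto simp: complex_polynomial_map_def intro: regular_polynomial_function)
    then show ?thesis using F(2) by (subst regular_cong) auto
  qed
  show ?thesis
    using b r unfolding surface_iso_def
    by (auto intro: regular simp: bij_betw_inv_into_left bij_betw_inv_into_right bij_betw_apply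
        bij_betw_apply[OF bij_betw_inv_into])
qed

lemma automorphism_signed_perm:
  assumes "f \<in> carrier (poly_Aut (surf k D))"
  obtains w \<pi> e where "bij \<pi>" "even_signs e"
    "\<And>v. v \<in> surf k D \<Longrightarrow> f v = word_act k w (signed_perm \<pi> e v)"
    "\<And>v. v \<in> surf k D \<Longrightarrow> signed_perm \<pi> e v \<in> surf k D"
proof -
  note P = automorphism_surface_iso[OF assms]
  obtain w \<pi> e where w: "bij \<pi>" "even_signs e" "\<forall>v\<in>surf k D. word_act k w (f v) = signed_perm \<pi> e v"
    using isomorphism_reducible[OF P] by (auto simp: reducible_to_linear_def)
  show thesis
  proof (rule that[OF w(1,2), of "rev w"])
    fix v assume v: "v \<in> surf k D"
    then show "f v = word_act k (rev w) (signed_perm \<pi> e v)" using w(3) by (metis word_act_rev_act)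
    show "signed_perm \<pi> e v \<in> surf k D"
      using v P w(3) word_act_in_surf[of "f v" k D w] by (simp add: surface_iso_def)
  qed
qed

definition signed_perms :: "((3 \<Rightarrow> 3) \<times> (3 \<Rightarrow> complex)) set" where
  "signed_perms = {(\<pi>, e). bij \<pi> \<and> even_signs e}"

lemma card_signed_perms: "finite signed_perms" "card signed_perms \<le> 24"
proof -
  \<comment> \<open>The third sign is the product of the first two.\<close>
  define F :: "(3 \<Rightarrow> 3) \<times> complex \<times> complex \<Rightarrow> (3 \<Rightarrow> 3) \<times> (3 \<Rightarrow> complex)"
    where "F = (\<lambda>(\<pi>, s, t). (\<pi>, \<lambda>j. (vector [s, t, s * t] :: complex ^ 3) $ j))"
  define A where "A = {\<pi> :: 3 \<Rightarrow> 3. \<pi> permutes UNIV} \<times> {1 :: complex, -1} \<times> {1 :: complex, -1}"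
  have finA: "finite A" by (simp add: A_def finite_permutations)
  have "card {\<pi> :: 3 \<Rightarrow> 3. \<pi> permutes UNIV} = 6"
    using card_permutations[of "UNIV :: 3 set" 3] by (simp add: fact_numeral)
  then have cardA: "card A = 24" by (simp add: A_def card_cartesian_product)
  have "signed_perms \<subseteq> F ` A"
  proof
    fix x assume "x \<in> signed_perms"
    then obtain \<pi> e where x: "x = (\<pi>, e)" "bij \<pi>" "even_signs e" by (auto simp: signed_perms_def)
    have e: "e 1 \<in> {1, -1}" "e 2 \<in> {1, -1}" "e 1 * e 2 * e 3 = 1"
      using x(3) by (auto simp: even_signs_def prod_UNIV_3)
    have "e 3 = (e 1 * e 1) * (e 2 * e 2) * e 3" using e(1,2) by auto
    also have "\<dots> = e 1 * e 2 * (e 1 * e 2 * e 3)" by (simp only: mult_ac)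
    finally have "e 3 = e 1 * e 2" using e(3) by simp
    then have "e = (\<lambda>j. (vector [e 1, e 2, e 1 * e 2] :: complex ^ 3) $ j)"
      by (simp add: fun_eq_iff forall_3)
    then have "x = F (\<pi>, e 1, e 2)" by (simp add: F_def x(1))
    moreover have "\<pi> permutes UNIV" by (rule bij_imp_permutes) (use x(2) in auto)
    then have "(\<pi>, e 1, e 2) \<in> A" using e(1,2) by (auto simp: A_def)
    ultimately show "x \<in> F ` A" by blast
  qed
  moreover have "card (F ` A) \<le> 24" using card_image_le[OF finA, of F] cardA by simp
  ultimately show "finite signed_perms" "card signed_perms \<le> 24"
    using finA by (auto intro: finite_subset) (meson card_mono finite_imageI le_trans)
qed

text \<open>
  Two automorphisms \<open>w \<sigma>\<close> and \<open>w' \<sigma>\<close> with the same signed permutation \<open>\<sigma>\<close> lie in the same coset, so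
  there are at most as many cosets as signed permutations.
\<close>

lemma rcosets_bound:
  fixes k :: "complex ^ 3" and D :: complex
  defines "H \<equiv> range (\<lambda>w. restrict (word_act k w) (surf k D))"
  shows "finite (rcosets\<^bsub>poly_Aut (surf k D)\<^esub> H) \<and> card (rcosets\<^bsub>poly_Aut (surf k D)\<^esub> H) \<le> 24"
proof -
  let ?S = "surf k D"
  define T where "T = (\<lambda>(\<pi>, e). range (\<lambda>u. \<lambda>v\<in>?S. word_act k u (signed_perm \<pi> e v)))"
  have "rcosets\<^bsub>poly_Aut ?S\<^esub> H \<subseteq> T ` signed_perms"
  proof
    fix X assume "X \<in> rcosets\<^bsub>poly_Aut ?S\<^esub> H"
    then obtain f where f: "f \<in> carrier (poly_Aut ?S)" "X = H #>\<^bsub>poly_Aut ?S\<^esub> f" by (auto simp: RCOSETS_def)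
    obtain w \<pi> e where w: "bij \<pi>" "even_signs e"
      "\<And>v. v \<in> ?S \<Longrightarrow> f v = word_act k w (signed_perm \<pi> e v)"
      using automorphism_signed_perm[OF f(1)] by metis
    have fB: "f \<in> Bij ?S" using f(1) by (simp add: carrier_poly_Aut)
    then have fS: "f v \<in> ?S" if "v \<in> ?S" for v using that by (auto simp: Bij_def bij_betw_def)
    have m: "restrict (word_act k u) ?S \<otimes>\<^bsub>poly_Aut ?S\<^esub> f = (\<lambda>v\<in>?S. word_act k (u @ w) (signed_perm \<pi> e v))" for u
      unfolding mult_poly_Aut[OF restrict_act_Bij fB]
      by (auto simp: compose_def restrict_def fun_eq_iff word_act_append fS simp flip: w(3))
    have "X = range (\<lambda>u. \<lambda>v\<in>?S. word_act k (u @ w) (signed_perm \<pi> e v))"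
      by (auto simp: f(2) r_coset_def H_def m)
    also have "\<dots> = T (\<pi>, e)"
    proof -
      \<comment> \<open>Right multiplication by \<open>w\<close> permutes the words modulo cancellation.\<close>
      have "(\<lambda>v\<in>?S. word_act k u (signed_perm \<pi> e v))
          = (\<lambda>v\<in>?S. word_act k ((u @ rev w) @ w) (signed_perm \<pi> e v))" for u
        by (simp add: word_act_append)
      then have "(\<lambda>v\<in>?S. word_act k u (signed_perm \<pi> e v))
          \<in> range (\<lambda>u. \<lambda>v\<in>?S. word_act k (u @ w) (signed_perm \<pi> e v))" for u
        by (rule range_eqI)
      then show ?thesis by (auto simp: T_def)
    qed
    finally show "X \<in> T ` signed_perms" using w by (auto simp: signed_perms_def)
  qed
  moreover have "card (T ` signed_perms) \<le> 24" "finite (T ` signed_perms)"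
    using card_image_le[OF card_signed_perms(1), of T] card_signed_perms by auto
  ultimately show ?thesis by (meson card_mono finite_subset le_trans)
qed

section \<open>Generic parameters\<close>

lemma linear_form_zero:
  assumes "\<And>v. v \<in> surf k D \<Longrightarrow> (\<Sum>i\<in>UNIV. p i * v $ i) = 0"
  shows "p i = 0"
proof -
  have "poly [:0, p 3:] (v $ 3) + poly [:p 1:] (v $ 3) * v $ 1 + poly [:p 2:] (v $ 3) * v $ 2 = 0"
    if "v \<in> surf k D" for v
    using assms[OF that] by (simp add: sum_3 algebra_simps)
  from linear_unique[OF this] show ?thesis using exhaust_3[of i] by auto
qed

lemma even_signs_square:
  assumes "even_signs e"
  shows "(e j)\<^sup>2 = 1"
proof -
  have "e j = 1 \<or> e j = -1" using assms by (simp add: even_signs_def)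
  then show ?thesis by auto
qed

text \<open>
  A signed permutation preserves \<open>x\<^sup>2 + y\<^sup>2 + z\<^sup>2\<close> and \<open>x y z\<close>. If it also preserves the surface, it fixes
  the linear form of the equation, because no nonzero linear form vanishes on the surface.
\<close>

lemma signed_perm_coefficients:
  assumes \<pi>: "bij \<pi>" and e: "even_signs e"
    and S: "\<And>v. v \<in> surf k D \<Longrightarrow> signed_perm \<pi> e v \<in> surf k D"
  shows "k $ j * e j = k $ \<pi> j"
proof -
  define \<rho> where "\<rho> = inv_into UNIV \<pi>"
  have \<rho>: "\<rho> (\<pi> i) = i" "\<pi> (\<rho> i) = i" for i
    using \<pi> by (simp_all add: \<rho>_def bij_is_inj bij_is_surj surj_f_inv_f)
  have "(\<Sum>i\<in>UNIV. (k $ \<rho> i * e (\<rho> i) - k $ i) * v $ i) = 0" if v: "v \<in> surf k D" for v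
  proof -
    note e2 = even_signs_square[OF e]
    have "(\<Sum>j\<in>UNIV. (e j * v $ \<pi> j)\<^sup>2) = (\<Sum>j\<in>UNIV. (v $ \<pi> j)\<^sup>2)"
      by (simp add: power_mult_distrib e2)
    also have "\<dots> = (\<Sum>i\<in>UNIV. (v $ i)\<^sup>2)" by (rule sum.reindex_bij_betw[OF \<pi>])
    finally have 1: "(\<Sum>j\<in>UNIV. (e j * v $ \<pi> j)\<^sup>2) = (\<Sum>i\<in>UNIV. (v $ i)\<^sup>2)" .
    have "(\<Prod>j\<in>UNIV. e j * v $ \<pi> j) = (\<Prod>j\<in>UNIV. v $ \<pi> j)"
      using e by (simp add: prod.distrib even_signs_def)
    also have "\<dots> = (\<Prod>i\<in>UNIV. v $ i)" by (rule prod.reindex_bij_betw[OF \<pi>])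
    finally have 2: "(\<Prod>j\<in>UNIV. e j * v $ \<pi> j) = (\<Prod>i\<in>UNIV. v $ i)" .
    have "(\<Sum>i\<in>UNIV. k $ \<rho> i * e (\<rho> i) * v $ i) = (\<Sum>j\<in>UNIV. k $ \<rho> (\<pi> j) * e (\<rho> (\<pi> j)) * v $ \<pi> j)"
      by (rule sum.reindex_bij_betw[OF \<pi>, symmetric])
    also have "\<dots> = (\<Sum>j\<in>UNIV. k $ j * (e j * v $ \<pi> j))" by (simp add: \<rho> mult.assoc)
    also have "\<dots> = (\<Sum>i\<in>UNIV. k $ i * v $ i)"
      using S[OF v] v 1 2 by (simp add: surf_def signed_perm_def)
    finally show ?thesis by (simp add: left_diff_distrib sum_subtractf)
  qed
  from linear_form_zero[OF this, where i = "\<pi> j"] show ?thesis by (simp add: \<rho>)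
qed

lemma generic_signed_perm_trivial:
  assumes \<pi>: "bij \<pi>" and e: "even_signs e"
    and S: "\<And>v. v \<in> surf k D \<Longrightarrow> signed_perm \<pi> e v \<in> surf k D"
    and gen: "\<And>i. k $ i \<noteq> 0" "\<And>i j. i \<noteq> j \<Longrightarrow> (k $ i)\<^sup>2 \<noteq> (k $ j)\<^sup>2"
  shows "signed_perm \<pi> e v = v"
proof -
  note c = signed_perm_coefficients[OF \<pi> e S]
  have "\<pi> j = j" for j
  proof (rule ccontr)
    assume "\<pi> j \<noteq> j"
    then have "(k $ \<pi> j)\<^sup>2 \<noteq> (k $ j)\<^sup>2" by (rule gen)
    moreover have "(e j)\<^sup>2 = 1" by (rule even_signs_square[OF e])
    ultimately show False by (simp add: c[symmetric] power_mult_distrib)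
  qed
  moreover from this have "e j = 1" for j using c[of j] gen(1)[of j] by simp
  ultimately show ?thesis by (simp add: signed_perm_def vec_eq_iff)
qed

lemma generic_surface_action_iso:
  fixes A B C D :: complex
  defines "k \<equiv> vector [A, B, C] :: complex ^ 3"
  assumes gen: "\<And>i. k $ i \<noteq> 0" "\<And>i j. i \<noteq> j \<Longrightarrow> (k $ i)\<^sup>2 \<noteq> (k $ j)\<^sup>2"
  shows "surface_action A B C D \<in> iso Gamma2 (poly_Aut (cubic_surface A B C D))"
proof -
  have S: "cubic_surface A B C D = surf k D" by (simp add: k_def cubic_surface_eq)
  have m: "surface_action A B C D \<in> hom Gamma2 (poly_Aut (surf k D))"
    "inj_on (surface_action A B C D) (carrier Gamma2)"
    using surface_action_mon[of A B C D] by (auto simp: mon_def S)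
  have "f \<in> surface_action A B C D ` carrier Gamma2" if f: "f \<in> carrier (poly_Aut (surf k D))" for f
  proof -
    obtain w \<pi> e where w: "bij \<pi>" "even_signs e"
      "\<And>v. v \<in> surf k D \<Longrightarrow> f v = word_act k w (signed_perm \<pi> e v)"
      "\<And>v. v \<in> surf k D \<Longrightarrow> signed_perm \<pi> e v \<in> surf k D"
      using automorphism_signed_perm[OF f] by metis
    have "signed_perm \<pi> e v = v" for v
      by (rule generic_signed_perm_trivial[OF w(1,2,4) gen])
    then have "f v = word_act k w v" if "v \<in> surf k D" for v using w(3)[OF that] by simp
    moreover have "f \<in> extensional (surf k D)" using f by (simp add: carrier_poly_Aut Bij_def)
    ultimately have "f = surface_action A B C D (word_class w)"
      unfolding surface_action_word S k_def[symmetric]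
      by (intro extensionalityI[of f "surf k D"]) auto
    then show ?thesis by (auto simp: carrier_Gamma2)
  qed
  then have "surface_action A B C D ` carrier Gamma2 = carrier (poly_Aut (surf k D))"
    using m(1) by (auto simp: hom_def)
  then show ?thesis using m by (simp add: iso_def bij_betw_def S)
qed

theorem theoremA:
  shows "(\<forall>A B C D.
            surface_action A B C D \<in> mon Gamma2 (poly_Aut (cubic_surface A B C D)) \<and>
            finite (rcosets\<^bsub>poly_Aut (cubic_surface A B C D)\<^esub>
              (surface_action A B C D ` carrier Gamma2)) \<and>
            card (rcosets\<^bsub>poly_Aut (cubic_surface A B C D)\<^esub>
              (surface_action A B C D ` carrier Gamma2)) \<le> 24)
       \<and> (\<exists>Z :: (complex ^ 4) set. zariski_closed Z \<and> Z \<noteq> UNIV \<and>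
            (\<forall>A B C D. vector [A, B, C, D] \<notin> Z \<longrightarrow>
              surface_action A B C D \<in> iso Gamma2 (poly_Aut (cubic_surface A B C D))))"
proof (rule conjI)
  show "\<forall>A B C D.
            surface_action A B C D \<in> mon Gamma2 (poly_Aut (cubic_surface A B C D)) \<and>
            finite (rcosets\<^bsub>poly_Aut (cubic_surface A B C D)\<^esub>
              (surface_action A B C D ` carrier Gamma2)) \<and>
            card (rcosets\<^bsub>poly_Aut (cubic_surface A B C D)\<^esub>
              (surface_action A B C D ` carrier Gamma2)) \<le> 24"
  proof (intro allI)
    fix A B C D
    have "surface_action A B C D ` carrier Gamma2
        = range (\<lambda>w. restrict (word_act (vector [A, B, C]) w) (surf (vector [A, B, C]) D))"
      by (auto simp: carrier_Gamma2 surface_action_word cubic_surface_eq image_image)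
    then show "surface_action A B C D \<in> mon Gamma2 (poly_Aut (cubic_surface A B C D)) \<and>
            finite (rcosets\<^bsub>poly_Aut (cubic_surface A B C D)\<^esub>
              (surface_action A B C D ` carrier Gamma2)) \<and>
            card (rcosets\<^bsub>poly_Aut (cubic_surface A B C D)\<^esub>
              (surface_action A B C D ` carrier Gamma2)) \<le> 24"
      using surface_action_mon[of A B C D] rcosets_bound[of "vector [A, B, C]" D]
      by (simp add: cubic_surface_eq)
  qed
next
  \<comment> \<open>The nonvanishing of \<open>p\<close> says that \<open>A, B, C\<close> are nonzero with distinct squares.\<close>
  define p :: "complex ^ 4 \<Rightarrow> complex" where
    "p v = v $ 1 * v $ 2 * v $ 3 * (v $ 1 * v $ 1 - v $ 2 * v $ 2)
      * (v $ 2 * v $ 2 - v $ 3 * v $ 3) * (v $ 1 * v $ 1 - v $ 3 * v $ 3)" for v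
  have "complex_polynomial_function p"
    unfolding p_def
    by (intro polynomial_function_diff complex_polynomial_function.mult complex_polynomial_function.coord)
  then have "zariski_closed {v. p v = 0}"
    unfolding zariski_closed_def by (intro exI[of _ "{p}"]) auto
  moreover have "{v. p v = 0} \<noteq> UNIV"
  proof -
    have "p (vector [1, 2, 3, 0]) \<noteq> 0" by (simp add: p_def vector_def)
    then show ?thesis by blast
  qed
  moreover have "surface_action A B C D \<in> iso Gamma2 (poly_Aut (cubic_surface A B C D))"
    if "vector [A, B, C, D] \<notin> {v. p v = 0}" for A B C D
  proof (rule generic_surface_action_iso)
    have "A * B * C * (A * A - B * B) * (B * B - C * C) * (A * A - C * C) \<noteq> 0"
      using that by (simp add: p_def vector_def)
    then have g: "A \<noteq> 0" "B \<noteq> 0" "C \<noteq> 0" "A\<^sup>2 \<noteq> B\<^sup>2" "B\<^sup>2 \<noteq> C\<^sup>2" "A\<^sup>2 \<noteq> C\<^sup>2"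
      by (auto simp: power2_eq_square)
    show "(vector [A, B, C] :: complex ^ 3) $ i \<noteq> 0" for i
      using g exhaust_3[of i] by auto
    show "((vector [A, B, C] :: complex ^ 3) $ i)\<^sup>2 \<noteq> ((vector [A, B, C] :: complex ^ 3) $ j)\<^sup>2"
      if "i \<noteq> j" for i j
      using g that exhaust_3[of i] exhaust_3[of j] by (elim disjE; simp; metis)
  qed
  ultimately show "\<exists>Z :: (complex ^ 4) set. zariski_closed Z \<and> Z \<noteq> UNIV \<and>
            (\<forall>A B C D. vector [A, B, C, D] \<notin> Z \<longrightarrow>
              surface_action A B C D \<in> iso Gamma2 (poly_Aut (cubic_surface A B C D)))"
    by blast
qed

end
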